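(* Let $p$ be an odd prime. Suppose that $\alpha\in\mathbb Z_p$ and $z\in\mathbb Z_p^\times$ with $z+1$ prime to $p$. Then $$ {}_2F_1\bigg[\begin{matrix}\alpha&\alpha\\&1\end{matrix}\bigg|\,z\bigg]_{p-1}+z^{1-\lambda_p(\alpha)}{}_2F_1\bigg[\begin{matrix}\alpha&\alpha\\&1\end{matrix}\bigg|\,\frac{1}{z}\bigg]_{p-1}\equiv(1+z)^{1-\lambda_p(\alpha)}{}_2F_1\bigg[\begin{matrix}\frac12\alpha&\frac12+\frac12\alpha\\&1\end{matrix}\bigg|\,\frac{4z}{(1+z)^2}\bigg]_{p-1}\pmod{p^2}. $$
   Context: $\mathbb Z_p$ denotes the $p$-adic integers and $\mathbb Z_p^\times$ its units. For $\alpha\in\mathbb Z_p$, $\langle\alpha\rangle_p$ is the unique integer in $\{0,1,\ldots,p-1\}$ congruent to $\alpha$ modulo $p$, and $\lambda_p(\alpha):=-\langle-\alpha\rangle_p+\frac{\alpha+\langle-\alpha\rangle_p}{p}\cdot(p-1)$. For $a\in\mathbb Z$, $s\in\mathbb Z_p$ and $w\in\mathbb Z_p^\times$, the power $w^{a+s(p-1)}$ is defined as $w^{a}\sum_{k=0}^\infty\binom{s}{k}(w^{p-1}-1)^k$ (this is well defined); in particular $w^{1-\lambda_p(\alpha)}$ is defined for $w\in\mathbb Z_p^\times$. Pochhammer symbol: $(x)_0=1$, $(x)_k=x(x+1)\cdots(x+k-1)$. For $n\ge 0$, ${}_{2}F_1\Big[\begin{matrix}\alpha&\beta\\&\gamma\end{matrix}\Big|\,z\Big]_n=\sum_{k=0}^{n}\frac{(\alpha)_k(\beta)_k}{(\gamma)_k}\cdot\frac{z^k}{k!}$.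 For $x,y\in\mathbb Z_p$, $x\equiv y\pmod{p^2}$ means $x-y\in p^2\mathbb Z_p$. *)

theory Defs
  imports "HOL-Analysis.Analysis" "Berlekamp_Zassenhaus.Finite_Field"
begin

section \<open>The \<open>p\<close>-adic absolute value on the rationals\<close>

definition padic_abs :: "nat \<Rightarrow> rat \<Rightarrow> real" where
  "padic_abs p r = (if r = 0 then 0 else
     real p powi (int (multiplicity (int p) (snd (quotient_of r)))
                - int (multiplicity (int p) (fst (quotient_of r)))))"

lemma rat_quotient:
  obtains a b where "b \<noteq> 0" "(r::rat) = of_int a / of_int b"
proof -
  obtain c d where cd: "quotient_of r = (c, d)" by (cases "quotient_of r")
  show ?thesis
    using that[of d c] quotient_of_denom_pos[OF cd] quotient_of_div[OF cd] by auto
qed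

context
  fixes p :: nat
  assumes p: "prime p"
begin

lemma padic_abs_0 [simp]: "padic_abs p 0 = 0"
  by (simp add: padic_abs_def)

lemma padic_abs_divide:
  assumes "a \<noteq> 0" "b \<noteq> 0"
  shows "padic_abs p (of_int a / of_int b) =
    real p powi (int (multiplicity (int p) b) - int (multiplicity (int p) a))"
proof -
  define r :: rat where "r = of_int a / of_int b"
  obtain c d where cd: "quotient_of r = (c, d)" by (cases "quotient_of r")
  have d: "d > 0" using quotient_of_denom_pos[OF cd] .
  have r: "r = of_int c / of_int d" using quotient_of_div[OF cd] .
  have r0: "r \<noteq> 0" using assms by (simp add: r_def)
  have c0: "c \<noteq> 0" using r r0 by auto
  have "(of_int (a * d) :: rat) = of_int (c * b)"
    using r assms d unfolding r_def by (simp add: field_simps)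
  hence eq: "a * d = c * b" by (simp only: of_int_eq_iff)
  have pe: "prime_elem (int p)" using p by simp
  have "multiplicity (int p) (a * d) = multiplicity (int p) (c * b)" using eq by simp
  hence "multiplicity (int p) a + multiplicity (int p) d =
         multiplicity (int p) c + multiplicity (int p) b"
    using assms c0 d pe by (simp add: prime_elem_multiplicity_mult_distrib)
  hence "int (multiplicity (int p) d) - int (multiplicity (int p) c) =
         int (multiplicity (int p) b) - int (multiplicity (int p) a)" by linarith
  thus ?thesis using r0 unfolding r_def[symmetric] padic_abs_def cd by simp
qed

lemma padic_abs_nonneg [simp]: "padic_abs p r \<ge> 0"
  by (simp add: padic_abs_def)

lemma padic_abs_eq_0_iff [simp]: "padic_abs p r = 0 \<longleftrightarrow> r = 0"
  using p by (auto simp: padic_abs_def power_int_eq_0_iff)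

lemma padic_abs_mult: "padic_abs p (r * s) = padic_abs p r * padic_abs p s"
proof (cases "r = 0 \<or> s = 0")
  case False
  obtain a b where ab: "b \<noteq> 0" "r = of_int a / of_int b" by (rule rat_quotient)
  obtain c d where cd: "d \<noteq> 0" "s = of_int c / of_int d" by (rule rat_quotient)
  have ac: "a \<noteq> 0" "c \<noteq> 0" using False ab cd by auto
  have "r * s = of_int (a * c) / of_int (b * d)" using ab cd by simp
  hence "padic_abs p (r * s) = real p powi
    (int (multiplicity (int p) (b * d)) - int (multiplicity (int p) (a * c)))"
    using padic_abs_divide[of "a * c" "b * d"] ab cd ac by simp
  also have "int (multiplicity (int p) (b * d)) - int (multiplicity (int p) (a * c)) =
    (int (multiplicity (int p) b) - int (multiplicity (int p) a)) +
    (int (multiplicity (int p) d) - int (multiplicity (int p) c))"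
    using ab cd ac p by (simp add: prime_elem_multiplicity_mult_distrib)
  also have "real p powi \<dots> = padic_abs p r * padic_abs p s"
    using p ab cd ac prime_gt_0_nat[OF p]
    by (subst power_int_add) (simp_all add: padic_abs_divide)
  finally show ?thesis .
qed auto

lemma padic_abs_1 [simp]: "padic_abs p 1 = 1"
  by (simp add: padic_abs_def)

lemma padic_abs_minus [simp]: "padic_abs p (- r) = padic_abs p r"
proof -
  have "padic_abs p (-1) * padic_abs p (-1) = 1"
    using padic_abs_mult[of "-1" "-1"] by simp
  hence "padic_abs p (-1) = 1"
    by (metis padic_abs_nonneg abs_of_nonneg abs_square_eq_1 power2_eq_square)
  thus ?thesis using padic_abs_mult[of "-1" r] by simp
qed

lemma padic_abs_diff_commute: "padic_abs p (r - s) = padic_abs p (s - r)"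
  by (metis minus_diff_eq padic_abs_minus)

lemma padic_abs_inverse: "padic_abs p (inverse r) = inverse (padic_abs p r)"
proof (cases "r = 0")
  case False
  have "padic_abs p (inverse r) * padic_abs p r = 1"
    using False by (simp flip: padic_abs_mult)
  thus ?thesis by (metis inverse_unique mult.commute)
qed auto

lemma padic_abs_of_int_le_1: "padic_abs p (of_int a) \<le> 1"
proof (cases "a = 0")
  case False
  have "padic_abs p (of_int a) = real p powi (- int (multiplicity (int p) a))"
    using padic_abs_divide[of a 1] False by simp
  also have "\<dots> \<le> 1"
    using prime_gt_0_nat[OF p]
    by (simp add: power_int_minus inverse_le_1_iff one_le_power)
  finally show ?thesis .
qed auto

lemma padic_abs_ultra: "padic_abs p (r + s) \<le> max (padic_abs p r) (padic_abs p s)"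
proof (cases "r = 0 \<or> s = 0 \<or> r + s = 0")
  case True
  thus ?thesis by (auto simp: max_def)
next
  case False
  obtain a' b where ab: "b \<noteq> 0" "r = of_int a' / of_int b" by (rule rat_quotient)
  obtain c' d where cd: "d \<noteq> 0" "s = of_int c' / of_int d" by (rule rat_quotient)
  define a c e where "a = a' * d" and "c = c' * b" and "e = b * d"
  have e0: "e \<noteq> 0" using ab cd by (simp add: e_def)
  have r: "r = of_int a / of_int e" and s: "s = of_int c / of_int e"
    using ab cd by (simp_all add: a_def c_def e_def)
  have rs: "r + s = of_int (a + c) / of_int e"
    by (simp add: r s add_divide_distrib)
  have nz: "a \<noteq> 0" "c \<noteq> 0" "a + c \<noteq> 0"
    using False r s rs by auto
  let ?m = "multiplicity (int p)"
  have nu: "\<not> is_unit (int p)" using p by (simp add: prime_nat_iff)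
  have "min (?m a) (?m c) \<le> ?m (a + c)"
  proof (rule multiplicity_geI)
    show "int p ^ min (?m a) (?m c) dvd a + c"
      by (intro dvd_add multiplicity_dvd') simp_all
  qed (fact nz(3) nu)+
  hence "?m a \<le> ?m (a + c) \<or> ?m c \<le> ?m (a + c)" by linarith
  moreover have "padic_abs p (r + s) \<le> padic_abs p (of_int x / of_int e)"
    if "?m x \<le> ?m (a + c)" "x \<noteq> 0" for x
  proof -
    have "real p \<ge> 1" using prime_gt_0_nat[OF p] by linarith
    thus ?thesis unfolding rs padic_abs_divide[OF nz(3) e0] padic_abs_divide[OF that(2) e0]
      using that(1) by (intro power_int_increasing) auto
  qed
  ultimately show ?thesis using nz unfolding r s
    by (metis max.coboundedI1 max.coboundedI2 r s)
qed

lemma padic_abs_triangle: "padic_abs p (r + s) \<le> padic_abs p r + padic_abs p s"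
  using padic_abs_ultra[of r s] padic_abs_nonneg[of r] padic_abs_nonneg[of s] by linarith

lemma padic_abs_triangle_rev: "\<bar>padic_abs p r - padic_abs p s\<bar> \<le> padic_abs p (r - s)"
  using padic_abs_triangle[of "r - s" s] padic_abs_triangle[of "s - r" r]
  by (simp add: padic_abs_diff_commute)

end

section \<open>Cauchy sequences\<close>

definition padic_Cauchy :: "nat \<Rightarrow> (nat \<Rightarrow> rat) \<Rightarrow> bool" where
  "padic_Cauchy p X \<longleftrightarrow>
     (\<forall>e>0. \<exists>N. \<forall>m\<ge>N. \<forall>n\<ge>N. padic_abs p (X m - X n) < e)"

definition padic_null :: "nat \<Rightarrow> (nat \<Rightarrow> rat) \<Rightarrow> bool" where
  "padic_null p X \<longleftrightarrow> (\<lambda>n. padic_abs p (X n)) \<longlonglongrightarrow> 0"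

context
  fixes p :: nat
  assumes p: "prime p"
begin

lemma padic_Cauchy_const [simp]: "padic_Cauchy p (\<lambda>n. c)"
  by (simp add: padic_Cauchy_def p)

lemma padic_Cauchy_add:
  assumes "padic_Cauchy p X" "padic_Cauchy p Y"
  shows "padic_Cauchy p (\<lambda>n. X n + Y n)"
  unfolding padic_Cauchy_def
proof (intro allI impI)
  fix e :: real assume e: "e > 0"
  obtain N where N: "\<And>m n. m \<ge> N \<Longrightarrow> n \<ge> N \<Longrightarrow> padic_abs p (X m - X n) < e"
    using assms(1) e unfolding padic_Cauchy_def by blast
  obtain M where M: "\<And>m n. m \<ge> M \<Longrightarrow> n \<ge> M \<Longrightarrow> padic_abs p (Y m - Y n) < e"
    using assms(2) e unfolding padic_Cauchy_def by blast
  have "padic_abs p (X m + Y m - (X n + Y n)) < e" if "m \<ge> max N M" "n \<ge> max N M" for m n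
    using padic_abs_ultra[OF p, of "X m - X n" "Y m - Y n"] N[of m n] M[of m n] that
    by (simp add: add_diff_add)
  thus "\<exists>N. \<forall>m\<ge>N. \<forall>n\<ge>N. padic_abs p (X m + Y m - (X n + Y n)) < e" by blast
qed

lemma padic_Cauchy_uminus:
  assumes "padic_Cauchy p X"
  shows "padic_Cauchy p (\<lambda>n. - X n)"
proof -
  have "padic_abs p (- X m - - X n) = padic_abs p (X m - X n)" for m n
    by (metis minus_diff_minus padic_abs_minus[OF p])
  thus ?thesis using assms by (simp add: padic_Cauchy_def)
qed

lemma padic_Cauchy_abs_convergent:
  assumes "padic_Cauchy p X"
  shows "convergent (\<lambda>n. padic_abs p (X n))"
proof -
  have "Cauchy (\<lambda>n. padic_abs p (X n))"
    unfolding Cauchy_def dist_real_def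
    using assms padic_abs_triangle_rev[OF p] unfolding padic_Cauchy_def
    by (meson order_le_less_trans)
  thus ?thesis by (simp add: Cauchy_convergent_iff)
qed

lemma padic_Cauchy_lim:
  "padic_Cauchy p X \<Longrightarrow> (\<lambda>n. padic_abs p (X n)) \<longlonglongrightarrow> lim (\<lambda>n. padic_abs p (X n))"
  using padic_Cauchy_abs_convergent by (simp add: convergent_LIMSEQ_iff)

lemma padic_Cauchy_bounded:
  assumes "padic_Cauchy p X"
  obtains B where "B > 0" "\<And>n. padic_abs p (X n) \<le> B"
proof -
  have "Bseq (\<lambda>n. padic_abs p (X n))"
    using padic_Cauchy_abs_convergent[OF assms] by (rule convergent_imp_Bseq)
  then obtain B where "B > 0" "\<forall>n. norm (padic_abs p (X n)) \<le> B"
    unfolding Bseq_def by blast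
  hence "B > 0" "\<And>n. padic_abs p (X n) \<le> B" using p by simp_all
  thus ?thesis using that by blast
qed

lemma padic_Cauchy_mult:
  assumes "padic_Cauchy p X" "padic_Cauchy p Y"
  shows "padic_Cauchy p (\<lambda>n. X n * Y n)"
  unfolding padic_Cauchy_def
proof (intro allI impI)
  fix e :: real assume e: "e > 0"
  obtain B where B: "B > 0" "\<And>n. padic_abs p (X n) \<le> B"
    using padic_Cauchy_bounded[OF assms(1)] by blast
  obtain C where C: "C > 0" "\<And>n. padic_abs p (Y n) \<le> C"
    using padic_Cauchy_bounded[OF assms(2)] by blast
  obtain N where N: "\<And>m n. m \<ge> N \<Longrightarrow> n \<ge> N \<Longrightarrow> padic_abs p (X m - X n) < e / C"
    using assms(1) e C unfolding padic_Cauchy_def by (meson divide_pos_pos)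
  obtain M where M: "\<And>m n. m \<ge> M \<Longrightarrow> n \<ge> M \<Longrightarrow> padic_abs p (Y m - Y n) < e / B"
    using assms(2) e B unfolding padic_Cauchy_def by (meson divide_pos_pos)
  have "padic_abs p (X m * Y m - X n * Y n) < e" if mn: "m \<ge> max N M" "n \<ge> max N M" for m n
  proof -
    have "padic_abs p (X m * Y m - X n * Y n) =
      padic_abs p (X m * (Y m - Y n) + (X m - X n) * Y n)" by (simp add: algebra_simps)
    also have "\<dots> \<le> max (padic_abs p (X m) * padic_abs p (Y m - Y n))
                        (padic_abs p (X m - X n) * padic_abs p (Y n))"
      using padic_abs_ultra[OF p] by (metis padic_abs_mult[OF p])
    also have "\<dots> < e"
    proof -
      have "padic_abs p (X m) * padic_abs p (Y m - Y n) \<le> B * padic_abs p (Y m - Y n)"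
        using B p by (intro mult_right_mono) auto
      also have "\<dots> < e" using M[of m n] mn B by (simp add: field_simps)
      finally have 1: "padic_abs p (X m) * padic_abs p (Y m - Y n) < e" .
      have "padic_abs p (X m - X n) * padic_abs p (Y n) \<le> padic_abs p (X m - X n) * C"
        using C p by (intro mult_left_mono) auto
      also have "\<dots> < e" using N[of m n] mn C by (simp add: field_simps)
      finally show ?thesis using 1 by simp
    qed
    finally show ?thesis .
  qed
  thus "\<exists>N. \<forall>m\<ge>N. \<forall>n\<ge>N. padic_abs p (X m * Y m - X n * Y n) < e" by blast
qed

lemma padic_Cauchy_not_null:
  assumes "padic_Cauchy p X" "\<not> padic_null p X"
  obtains c N where "c > 0" "\<And>n. n \<ge> N \<Longrightarrow> padic_abs p (X n) > c"
proof -
  define L where "L = lim (\<lambda>n. padic_abs p (X n))"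
  have lim: "(\<lambda>n. padic_abs p (X n)) \<longlonglongrightarrow> L"
    unfolding L_def by (rule padic_Cauchy_lim[OF assms(1)])
  have "L \<ge> 0" by (rule LIMSEQ_le_const[OF lim]) (use p in auto)
  moreover have "L \<noteq> 0" using lim assms(2) by (auto simp: padic_null_def)
  ultimately have L: "L > 0" by simp
  hence "eventually (\<lambda>n. padic_abs p (X n) > L / 2) sequentially"
    by (intro order_tendstoD(1)[OF lim]) simp
  then obtain N where "\<forall>n\<ge>N. padic_abs p (X n) > L / 2"
    unfolding eventually_sequentially by blast
  thus ?thesis using that[of "L / 2" N] L by simp
qed

lemma padic_Cauchy_inverse:
  assumes "padic_Cauchy p X" "\<not> padic_null p X"
  shows "padic_Cauchy p (\<lambda>n. inverse (X n))"
  unfolding padic_Cauchy_def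
proof (intro allI impI)
  fix e :: real assume e: "e > 0"
  obtain c N where c: "c > 0" "\<And>n. n \<ge> N \<Longrightarrow> padic_abs p (X n) > c"
    using padic_Cauchy_not_null[OF assms] by blast
  have "e * c\<^sup>2 > 0" using e c by simp
  then obtain M where M: "\<And>m n. m \<ge> M \<Longrightarrow> n \<ge> M \<Longrightarrow> padic_abs p (X m - X n) < e * c\<^sup>2"
    using assms(1) unfolding padic_Cauchy_def by blast
  have "padic_abs p (inverse (X m) - inverse (X n)) < e"
    if mn: "m \<ge> max N M" "n \<ge> max N M" for m n
  proof -
    have cm: "padic_abs p (X m) > c" and cn: "padic_abs p (X n) > c" using c mn by auto
    have nz: "X m \<noteq> 0" "X n \<noteq> 0" using cm cn c(1) p by auto
    have "inverse (X m) - inverse (X n) = (X n - X m) * inverse (X m * X n)"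
      using nz by (simp add: field_simps)
    hence "padic_abs p (inverse (X m) - inverse (X n)) =
      padic_abs p (X n - X m) / (padic_abs p (X m) * padic_abs p (X n))"
      using p by (simp add: padic_abs_mult padic_abs_inverse divide_inverse)
    also have "\<dots> \<le> padic_abs p (X n - X m) / c\<^sup>2"
      using cm cn c(1) p unfolding power2_eq_square
      by (intro divide_left_mono mult_mono mult_pos_pos) auto
    also have "\<dots> < e" using M[of n m] mn c(1) by (simp add: field_simps)
    finally show ?thesis .
  qed
  thus "\<exists>N. \<forall>m\<ge>N. \<forall>n\<ge>N. padic_abs p (inverse (X m) - inverse (X n)) < e" by blast
qed

lemma padic_null_zero [simp]: "padic_null p (\<lambda>n. 0)"
  by (simp add: padic_null_def p)

lemma padic_null_uminus: "padic_null p X \<Longrightarrow> padic_null p (\<lambda>n. - X n)"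
  by (simp add: padic_null_def p)

lemma padic_null_add:
  assumes "padic_null p X" "padic_null p Y"
  shows "padic_null p (\<lambda>n. X n + Y n)"
  unfolding padic_null_def
proof (rule tendsto_sandwich[OF _ _ tendsto_const])
  show "(\<lambda>n. padic_abs p (X n) + padic_abs p (Y n)) \<longlonglongrightarrow> 0"
    using tendsto_add[OF assms[unfolded padic_null_def]] by simp
qed (use p padic_abs_triangle in auto)

lemma padic_null_mult:
  assumes "padic_Cauchy p X" "padic_null p Y"
  shows "padic_null p (\<lambda>n. X n * Y n)"
  using tendsto_mult[OF padic_Cauchy_lim[OF assms(1)] assms(2)[unfolded padic_null_def]]
  by (simp add: padic_null_def padic_abs_mult[OF p])

lemma padic_null_lim_eq:
  assumes "padic_Cauchy p X" "padic_Cauchy p Y" "padic_null p (\<lambda>n. X n - Y n)"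
  shows "lim (\<lambda>n. padic_abs p (X n)) = lim (\<lambda>n. padic_abs p (Y n))"
proof -
  have "(\<lambda>n. padic_abs p (X n) - padic_abs p (Y n)) \<longlonglongrightarrow> 0"
  proof (rule Lim_null_comparison)
    show "(\<lambda>n. padic_abs p (X n - Y n)) \<longlonglongrightarrow> 0" using assms(3) by (simp add: padic_null_def)
  qed (use p padic_abs_triangle_rev in auto)
  moreover have "(\<lambda>n. padic_abs p (X n) - padic_abs p (Y n)) \<longlonglongrightarrow>
      lim (\<lambda>n. padic_abs p (X n)) - lim (\<lambda>n. padic_abs p (Y n))"
    by (intro tendsto_diff padic_Cauchy_lim assms)
  ultimately show ?thesis using LIMSEQ_unique by fastforce
qed

end

section \<open>The field of \<open>p\<close>-adic numbers\<close>

text \<open>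
  The prime is \<open>p = CARD('p)\<close>. The field \<open>'p padic\<close> of \<open>p\<close>-adic numbers is the completion of the
  rationals with respect to \<open>padic_abs p\<close>: Cauchy sequences modulo null sequences.
\<close>

typedef (overloaded) ('p::prime_card) padic_seq = "{X. padic_Cauchy CARD('p) X}"
  by (rule exI[of _ "\<lambda>n. 0"]) (simp add: prime_card)

setup_lifting type_definition_padic_seq

instantiation padic_seq :: (prime_card) comm_ring_1
begin

lift_definition zero_padic_seq :: "'a padic_seq" is "\<lambda>n. 0" by (simp add: prime_card)
lift_definition one_padic_seq :: "'a padic_seq" is "\<lambda>n. 1" by (simp add: prime_card)
lift_definition plus_padic_seq :: "'a padic_seq \<Rightarrow> 'a padic_seq \<Rightarrow> 'a padic_seq"
  is "\<lambda>X Y n. X n + Y n" by (simp add: padic_Cauchy_add prime_card)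
lift_definition uminus_padic_seq :: "'a padic_seq \<Rightarrow> 'a padic_seq"
  is "\<lambda>X n. - X n" by (simp add: padic_Cauchy_uminus prime_card)
lift_definition times_padic_seq :: "'a padic_seq \<Rightarrow> 'a padic_seq \<Rightarrow> 'a padic_seq"
  is "\<lambda>X Y n. X n * Y n" by (simp add: padic_Cauchy_mult prime_card)
definition minus_padic_seq :: "'a padic_seq \<Rightarrow> 'a padic_seq \<Rightarrow> 'a padic_seq"
  where "minus_padic_seq X Y = X + - Y"

instance
  by standard (unfold minus_padic_seq_def, (transfer; simp add: algebra_simps fun_eq_iff)+)

end

lemma Rep_padic_seq_minus:
  "Rep_padic_seq (X - Y) = (\<lambda>n. Rep_padic_seq X n - Rep_padic_seq Y n)"
  unfolding minus_padic_seq_def plus_padic_seq.rep_eq uminus_padic_seq.rep_eq by simp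

lift_definition padic_seq_null :: "'p::prime_card padic_seq \<Rightarrow> bool"
  is "padic_null CARD('p)" .

lift_definition padic_seq_norm :: "'p::prime_card padic_seq \<Rightarrow> real"
  is "\<lambda>X. lim (\<lambda>n. padic_abs CARD('p) (X n))" .

definition padic_rel :: "'p::prime_card padic_seq \<Rightarrow> 'p padic_seq \<Rightarrow> bool" where
  "padic_rel X Y \<longleftrightarrow> padic_seq_null (X - Y)"

lemma padic_seq_null_0 [simp]: "padic_seq_null 0"
  by transfer (simp add: prime_card)

lemma padic_seq_null_add: "padic_seq_null X \<Longrightarrow> padic_seq_null Y \<Longrightarrow> padic_seq_null (X + Y)"
  by transfer (simp add: padic_null_add prime_card)

lemma padic_seq_null_uminus: "padic_seq_null X \<Longrightarrow> padic_seq_null (- X)"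
  by transfer (simp add: padic_null_uminus prime_card)

lemma padic_seq_null_mult: "padic_seq_null Y \<Longrightarrow> padic_seq_null (X * Y)"
  by transfer (simp add: padic_null_mult prime_card)

lemma equivp_padic_rel: "equivp padic_rel"
proof (rule equivpI)
  show "reflp padic_rel" by (simp add: reflp_def padic_rel_def)
  show "symp padic_rel"
    unfolding symp_def padic_rel_def by (metis minus_diff_eq padic_seq_null_uminus)
  show "transp padic_rel"
    unfolding transp_def padic_rel_def
    by (metis diff_add_cancel add_diff_eq padic_seq_null_add)
qed

quotient_type (overloaded) 'p padic = "'p::prime_card padic_seq" / padic_rel
  by (rule equivp_padic_rel)

instantiation padic :: (prime_card) comm_ring_1
begin

lift_definition zero_padic :: "'a padic" is 0 .
lift_definition one_padic :: "'a padic" is 1 .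
lift_definition plus_padic :: "'a padic \<Rightarrow> 'a padic \<Rightarrow> 'a padic" is "(+)"
  unfolding padic_rel_def using padic_seq_null_add by (simp add: add_diff_add)
lift_definition uminus_padic :: "'a padic \<Rightarrow> 'a padic" is uminus
  unfolding padic_rel_def using padic_seq_null_uminus by (metis minus_diff_minus)
lift_definition minus_padic :: "'a padic \<Rightarrow> 'a padic \<Rightarrow> 'a padic" is "(-)"
proof -
  fix X Y X' Y' :: "'a padic_seq"
  assume "padic_rel X Y" "padic_rel X' Y'"
  hence "padic_seq_null ((X - Y) + - (X' - Y'))"
    unfolding padic_rel_def by (intro padic_seq_null_add padic_seq_null_uminus)
  thus "padic_rel (X - X') (Y - Y')"
    by (simp add: padic_rel_def algebra_simps)
qed
lift_definition times_padic :: "'a padic \<Rightarrow> 'a padic \<Rightarrow> 'a padic" is "(*)"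
proof -
  fix X Y X' Y' :: "'a padic_seq"
  assume "padic_rel X Y" "padic_rel X' Y'"
  hence "padic_seq_null (X * (X' - Y') + Y' * (X - Y))"
    unfolding padic_rel_def by (intro padic_seq_null_add padic_seq_null_mult)
  thus "padic_rel (X * X') (Y * Y')"
    by (simp add: padic_rel_def algebra_simps)
qed

instance
proof
  show "(0::'a padic) \<noteq> 1"
  proof transfer
    have "\<not> padic_seq_null (1 :: 'a padic_seq)"
      by transfer (simp add: padic_null_def prime_card LIMSEQ_const_iff)
    thus "\<not> padic_rel (0 :: 'a padic_seq) 1"
      using padic_seq_null_uminus[of "0 - 1 :: 'a padic_seq"] by (auto simp: padic_rel_def)
  qed
qed (transfer; simp add: padic_rel_def algebra_simps)+

end

lemma padic_inverse_exists:
  fixes x :: "'p::prime_card padic"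
  assumes "x \<noteq> 0"
  shows "\<exists>y. y * x = 1"
  using assms
proof transfer
  fix X :: "'p padic_seq"
  assume "\<not> padic_rel X 0"
  hence "\<not> padic_seq_null X" by (simp add: padic_rel_def)
  hence "\<exists>Y. padic_seq_null (Y * X - 1)"
    unfolding diff_conv_add_uminus
  proof transfer
    fix X :: "nat \<Rightarrow> rat"
    assume X: "padic_Cauchy CARD('p) X" "\<not> padic_null CARD('p) X"
    have "padic_Cauchy CARD('p) (\<lambda>n. inverse (X n))"
      using X by (simp add: padic_Cauchy_inverse prime_card)
    moreover obtain c N where c: "c > 0" "\<And>n. n \<ge> N \<Longrightarrow> padic_abs CARD('p) (X n) > c"
      using padic_Cauchy_not_null[OF prime_card X] by blast
    have "padic_abs CARD('p) (inverse (X n) * X n + - 1) = 0" if "n \<ge> N" for n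
      using c(2)[OF that] c(1) by (cases "X n = 0") (auto simp: prime_card)
    hence "padic_null CARD('p) (\<lambda>n. inverse (X n) * X n + - 1)"
      unfolding padic_null_def
      by (intro tendsto_eventually eventually_sequentiallyI)
    ultimately show "\<exists>Y\<in>{X. padic_Cauchy CARD('p) X}. padic_null CARD('p) (\<lambda>n. Y n * X n + - 1)"
      by (intro bexI[of _ "\<lambda>n. inverse (X n)"]) auto
  qed
  thus "\<exists>Y. padic_rel (Y * X) 1" by (simp add: padic_rel_def)
qed

instantiation padic :: (prime_card) field
begin

definition inverse_padic :: "'a padic \<Rightarrow> 'a padic" where
  "inverse_padic x = (if x = 0 then 0 else SOME y. y * x = 1)"

definition divide_padic :: "'a padic \<Rightarrow> 'a padic \<Rightarrow> 'a padic" where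
  "divide_padic x y = x * inverse y"

instance
proof
  fix x :: "'a padic"
  assume "x \<noteq> 0"
  thus "inverse x * x = 1"
    using someI_ex[OF padic_inverse_exists[of x]] by (simp add: inverse_padic_def)
qed (simp_all add: inverse_padic_def divide_padic_def)

end

lift_definition padic_norm :: "'p::prime_card padic \<Rightarrow> real" is padic_seq_norm
  unfolding padic_rel_def diff_conv_add_uminus
  by transfer (auto intro!: padic_null_lim_eq[OF prime_card])

lemma padic_norm_eq_0_iff: "padic_norm x = 0 \<longleftrightarrow> x = 0" for x :: "'p::prime_card padic"
proof transfer
  fix X :: "'p padic_seq"
  have "padic_seq_norm X = 0 \<longleftrightarrow> padic_seq_null X"
  proof transfer
    fix X :: "nat \<Rightarrow> rat"
    assume X: "padic_Cauchy CARD('p) X"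
    note lim = padic_Cauchy_lim[OF prime_card X]
    show "lim (\<lambda>n. padic_abs CARD('p) (X n)) = 0 \<longleftrightarrow> padic_null CARD('p) X"
      unfolding padic_null_def using lim limI by metis
  qed
  thus "padic_seq_norm X = 0 \<longleftrightarrow> padic_rel X 0" by (simp add: padic_rel_def)
qed

lemma padic_norm_nonneg: "padic_norm x \<ge> 0" for x :: "'p::prime_card padic"
proof (transfer, transfer)
  fix X :: "nat \<Rightarrow> rat"
  assume X: "padic_Cauchy CARD('p) X"
  show "0 \<le> lim (\<lambda>n. padic_abs CARD('p) (X n))"
    by (rule LIMSEQ_le_const[OF padic_Cauchy_lim[OF prime_card X]]) (auto simp: prime_card)
qed

lemma padic_norm_mult: "padic_norm (x * y) = padic_norm x * padic_norm y" for x y :: "'p::prime_card padic"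
proof (transfer, transfer)
  fix X Y :: "nat \<Rightarrow> rat"
  assume X: "padic_Cauchy CARD('p) X" and Y: "padic_Cauchy CARD('p) Y"
  have "(\<lambda>n. padic_abs CARD('p) (X n * Y n)) \<longlonglongrightarrow>
    lim (\<lambda>n. padic_abs CARD('p) (X n)) * lim (\<lambda>n. padic_abs CARD('p) (Y n))"
    using tendsto_mult[OF padic_Cauchy_lim[OF prime_card X] padic_Cauchy_lim[OF prime_card Y]]
    by (simp add: padic_abs_mult prime_card)
  thus "lim (\<lambda>n. padic_abs CARD('p) (X n * Y n)) =
    lim (\<lambda>n. padic_abs CARD('p) (X n)) * lim (\<lambda>n. padic_abs CARD('p) (Y n))"
    by (rule limI)
qed

lemma padic_norm_ultra: "padic_norm (x + y) \<le> max (padic_norm x) (padic_norm y)" for x y :: "'p::prime_card padic"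
proof (transfer, transfer)
  fix X Y :: "nat \<Rightarrow> rat"
  assume X: "padic_Cauchy CARD('p) X" and Y: "padic_Cauchy CARD('p) Y"
  show "lim (\<lambda>n. padic_abs CARD('p) (X n + Y n)) \<le>
    max (lim (\<lambda>n. padic_abs CARD('p) (X n))) (lim (\<lambda>n. padic_abs CARD('p) (Y n)))"
    by (rule LIMSEQ_le[OF padic_Cauchy_lim[OF prime_card padic_Cauchy_add[OF prime_card X Y]]
          tendsto_max[OF padic_Cauchy_lim[OF prime_card X] padic_Cauchy_lim[OF prime_card Y]]])
      (auto simp: padic_abs_ultra prime_card)
qed

lemma padic_norm_minus: "padic_norm (- x) = padic_norm x" for x :: "'p::prime_card padic"
  by (transfer, transfer) (simp add: prime_card)

instantiation padic :: (prime_card) metric_space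
begin

definition dist_padic :: "'a padic \<Rightarrow> 'a padic \<Rightarrow> real" where
  "dist_padic x y = padic_norm (x - y)"

definition uniformity_padic :: "('a padic \<times> 'a padic) filter" where
  "uniformity_padic = (INF e\<in>{0<..}. principal {(x, y). dist x y < e})"

definition open_padic :: "'a padic set \<Rightarrow> bool" where
  "open_padic U \<longleftrightarrow> (\<forall>x\<in>U. eventually (\<lambda>(x', y). x' = x \<longrightarrow> y \<in> U) uniformity)"

instance
proof
  fix x y z :: "'a padic"
  show "dist x y = 0 \<longleftrightarrow> x = y" by (simp add: dist_padic_def padic_norm_eq_0_iff)
  have "padic_norm (x - y) = padic_norm ((x - z) + - (y - z))" by simp
  also have "\<dots> \<le> max (padic_norm (x - z)) (padic_norm (- (y - z)))" by (rule padic_norm_ultra)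
  also have "\<dots> \<le> padic_norm (x - z) + padic_norm (y - z)"
    using padic_norm_nonneg[of "x - z"] padic_norm_nonneg[of "y - z"]
    unfolding padic_norm_minus by linarith
  finally show "dist x y \<le> dist x z + dist y z" by (simp add: dist_padic_def)
qed (rule uniformity_padic_def open_padic_def)+

end

lift_definition padic_seq_const :: "rat \<Rightarrow> 'p::prime_card padic_seq" is "\<lambda>r n. r"
  by (simp add: prime_card)

lift_definition padic_const :: "rat \<Rightarrow> 'p::prime_card padic" is padic_seq_const .

lemma padic_const_0: "padic_const 0 = 0"
  by transfer (simp add: padic_rel_def, transfer, simp add: prime_card)

lemma padic_norm_const: "padic_norm (padic_const r :: 'p::prime_card padic) = padic_abs CARD('p) r"
  by (transfer, transfer) simp

lemma padic_const_add: "padic_const (r + s) = padic_const r + (padic_const s :: 'p::prime_card padic)"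
proof transfer
  fix r s
  have "padic_seq_const (r + s) = padic_seq_const r + (padic_seq_const s :: 'p padic_seq)"
    by transfer simp
  thus "padic_rel (padic_seq_const (r + s)) (padic_seq_const r + (padic_seq_const s :: 'p padic_seq))"
    by (simp add: padic_rel_def)
qed

lemma padic_const_mult: "padic_const (r * s) = padic_const r * (padic_const s :: 'p::prime_card padic)"
proof transfer
  fix r s
  have "padic_seq_const (r * s) = padic_seq_const r * (padic_seq_const s :: 'p padic_seq)"
    by transfer simp
  thus "padic_rel (padic_seq_const (r * s)) (padic_seq_const r * (padic_seq_const s :: 'p padic_seq))"
    by (simp add: padic_rel_def)
qed

lemma padic_const_1: "padic_const 1 = (1 :: 'p::prime_card padic)"
proof transfer
  have "padic_seq_const 1 = (1 :: 'p padic_seq)" by transfer simp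
  thus "padic_rel (padic_seq_const 1) (1 :: 'p padic_seq)" by (simp add: padic_rel_def)
qed

lemma padic_const_of_nat: "padic_const (of_nat n) = of_nat n"
  by (induction n) (simp_all add: padic_const_0 padic_const_1 padic_const_add)

instance padic :: (prime_card) field_char_0
proof
  have "of_nat n \<noteq> (0 :: 'a padic)" if "n > 0" for n
  proof
    assume "of_nat n = (0 :: 'a padic)"
    hence "padic_norm (padic_const (of_nat n) :: 'a padic) = 0"
      by (simp add: padic_const_of_nat padic_norm_eq_0_iff)
    thus False using that by (simp add: padic_norm_const prime_card)
  qed
  hence 0: "of_nat n = (0 :: 'a padic) \<longleftrightarrow> n = 0" for n by auto
  have le: "m = n" if "of_nat m = (of_nat n :: 'a padic)" "m \<le> n" for m n
    using that 0[of "n - m"] by (simp add: of_nat_diff)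
  show "inj (of_nat :: nat \<Rightarrow> 'a padic)"
    by (rule injI) (metis le nat_le_linear)
qed

lemma padic_const_uminus: "padic_const (- r) = - padic_const r"
  using padic_const_add[of "- r" r] by (simp add: padic_const_0 eq_neg_iff_add_eq_0)

lemma padic_const_of_int: "padic_const (of_int a) = of_int a"
proof (cases a rule: int_cases2)
  case (nonneg n) thus ?thesis by (simp add: padic_const_of_nat)
next
  case (nonpos n) thus ?thesis by (simp add: padic_const_of_nat padic_const_uminus)
qed

lemma padic_const_eq_of_rat: "padic_const r = (of_rat r :: 'p::prime_card padic)"
proof -
  obtain a b where ab: "b \<noteq> 0" "r = of_int a / of_int b" by (rule rat_quotient)
  have "of_int b * padic_const r = (padic_const (of_int b * r) :: 'p padic)"
    by (simp only: padic_const_mult padic_const_of_int)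
  also have "of_int b * r = of_int a" using ab by simp
  also have "padic_const (of_int a) = (of_int a :: 'p padic)" by (rule padic_const_of_int)
  finally have "padic_const r = (of_int a / of_int b :: 'p padic)"
    using ab(1) by (simp add: eq_divide_eq mult.commute)
  also have "\<dots> = of_rat r" unfolding ab(2) by (simp add: of_rat_divide)
  finally show ?thesis .
qed

lemma padic_norm_of_rat: "padic_norm (of_rat r :: 'p::prime_card padic) = padic_abs CARD('p) r"
  using padic_norm_const[of r, where 'p = 'p] by (simp add: padic_const_eq_of_rat)

lemma padic_rat_Cauchy_tendsto:
  assumes "padic_Cauchy CARD('p::prime_card) R"
  shows "\<exists>x :: 'p padic. (\<lambda>n. of_rat (R n)) \<longlonglongrightarrow> x"
proof -
  define X :: "'p padic_seq" where "X = Abs_padic_seq R"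
  have R: "Rep_padic_seq X = R" using assms by (simp add: X_def Abs_padic_seq_inverse)
  have eq: "padic_norm (of_rat (R k) - abs_padic X) = lim (\<lambda>n. padic_abs CARD('p) (R k - R n))" for k
  proof -
    have "padic_norm (of_rat (R k) - abs_padic X) = padic_seq_norm (padic_seq_const (R k) + - X)"
      by (simp add: padic_const_eq_of_rat[symmetric] padic_const.abs_eq minus_padic.abs_eq
          padic_norm.abs_eq)
    also have "\<dots> = lim (\<lambda>n. padic_abs CARD('p) (R k - R n))"
      by (simp add: padic_seq_norm.rep_eq Rep_padic_seq_minus padic_seq_const.rep_eq R)
    finally show ?thesis .
  qed
  have "(\<lambda>n. of_rat (R n)) \<longlonglongrightarrow> abs_padic X"
    unfolding LIMSEQ_def
  proof (intro allI impI)
    fix e :: real assume e: "e > 0"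
    then obtain N where N: "\<And>m n. m \<ge> N \<Longrightarrow> n \<ge> N \<Longrightarrow> padic_abs CARD('p) (R m - R n) < e / 2"
      using assms unfolding padic_Cauchy_def by (meson half_gt_zero)
    have "dist (of_rat (R k)) (abs_padic X) < e" if k: "k \<ge> N" for k
    proof -
      have "padic_Cauchy CARD('p) (\<lambda>n. R k + - R n)"
        by (intro padic_Cauchy_add padic_Cauchy_uminus padic_Cauchy_const prime_card assms)
      hence "(\<lambda>n. padic_abs CARD('p) (R k - R n)) \<longlonglongrightarrow> lim (\<lambda>n. padic_abs CARD('p) (R k - R n))"
        by (auto dest: padic_Cauchy_lim[OF prime_card])
      hence "lim (\<lambda>n. padic_abs CARD('p) (R k - R n)) \<le> e / 2"
        by (rule LIMSEQ_le_const2) (use N[OF k] in \<open>auto intro: less_imp_le\<close>)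
      thus ?thesis using e by (simp add: dist_padic_def eq)
    qed
    thus "\<exists>N. \<forall>k\<ge>N. dist (of_rat (R k)) (abs_padic X) < e" by blast
  qed
  thus ?thesis by blast
qed

lemma padic_rat_dense:
  fixes x :: "'p::prime_card padic"
  assumes "e > 0"
  shows "\<exists>r. dist (of_rat r) x < e"
proof -
  obtain X where X: "x = abs_padic X" by (metis Quotient3_abs_rep[OF Quotient3_padic])
  have C: "padic_Cauchy CARD('p) (Rep_padic_seq X)" using Rep_padic_seq[of X] by simp
  obtain N where N: "\<And>m n. m \<ge> N \<Longrightarrow> n \<ge> N \<Longrightarrow>
      padic_abs CARD('p) (Rep_padic_seq X m - Rep_padic_seq X n) < e / 2"
    using C assms unfolding padic_Cauchy_def by (meson half_gt_zero)
  let ?r = "Rep_padic_seq X N"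
  have "padic_Cauchy CARD('p) (\<lambda>n. ?r + - Rep_padic_seq X n)"
    by (intro padic_Cauchy_add padic_Cauchy_uminus padic_Cauchy_const prime_card C)
  hence "(\<lambda>n. padic_abs CARD('p) (?r - Rep_padic_seq X n)) \<longlonglongrightarrow>
      lim (\<lambda>n. padic_abs CARD('p) (?r - Rep_padic_seq X n))"
    by (auto dest: padic_Cauchy_lim[OF prime_card])
  hence "lim (\<lambda>n. padic_abs CARD('p) (?r - Rep_padic_seq X n)) \<le> e / 2"
    by (rule LIMSEQ_le_const2) (use N[of N] in \<open>auto intro: less_imp_le\<close>)
  moreover have "dist (of_rat ?r) x = padic_seq_norm (padic_seq_const ?r + - X)"
    by (simp add: dist_padic_def X padic_const_eq_of_rat[symmetric] padic_const.abs_eq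
        minus_padic.abs_eq padic_norm.abs_eq)
  moreover have "\<dots> = lim (\<lambda>n. padic_abs CARD('p) (?r - Rep_padic_seq X n))"
    by (simp add: padic_seq_norm.rep_eq Rep_padic_seq_minus padic_seq_const.rep_eq)
  ultimately show ?thesis using assms by (intro exI[of _ ?r]) simp
qed

instance padic :: (prime_card) complete_space
proof
  fix x :: "nat \<Rightarrow> 'a padic"
  assume x: "Cauchy x"
  have "\<exists>r. dist (of_rat r) (x n) < inverse (real (Suc n))" for n
    by (rule padic_rat_dense) simp
  then obtain R where R: "\<And>n. dist (of_rat (R n)) (x n) < inverse (real (Suc n))" by metis
  have small: "\<exists>N. \<forall>n\<ge>N. dist (of_rat (R n)) (x n) < e" if e: "e > 0" for e :: real
  proof -
    obtain N where N: "inverse (real (Suc N)) < e" using reals_Archimedean[OF e] by blast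
    have "dist (of_rat (R n)) (x n) < e" if "n \<ge> N" for n
    proof -
      have "inverse (real (Suc n)) \<le> inverse (real (Suc N))"
        using that by (intro le_imp_inverse_le) auto
      thus ?thesis using R[of n] N by linarith
    qed
    thus ?thesis by blast
  qed
  have "padic_Cauchy CARD('a) R"
    unfolding padic_Cauchy_def
  proof (intro allI impI)
    fix e :: real assume "e > 0"
    hence e: "e / 3 > 0" by simp
    obtain N where N: "\<And>n. n \<ge> N \<Longrightarrow> dist (of_rat (R n)) (x n) < e / 3"
      using small[OF e] by blast
    obtain M where M: "\<And>m n. m \<ge> M \<Longrightarrow> n \<ge> M \<Longrightarrow> dist (x m) (x n) < e / 3"
      using x e unfolding Cauchy_def by blast
    have "padic_abs CARD('a) (R m - R n) < e" if mn: "m \<ge> max N M" "n \<ge> max N M" for m n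
    proof -
      have "padic_abs CARD('a) (R m - R n) = dist (of_rat (R m) :: 'a padic) (of_rat (R n))"
        by (simp add: dist_padic_def padic_norm_of_rat flip: of_rat_diff)
      also have "\<dots> \<le> dist (of_rat (R m)) (x m) + dist (x m) (x n) + dist (of_rat (R n)) (x n)"
        using dist_triangle[of "of_rat (R m)" "of_rat (R n)" "x m"]
          dist_triangle[of "x m" "of_rat (R n)" "x n"]
        by (simp add: dist_commute)
      also have "\<dots> < e" using N[of m] N[of n] M[of m n] mn by simp
      finally show ?thesis .
    qed
    thus "\<exists>N. \<forall>m\<ge>N. \<forall>n\<ge>N. padic_abs CARD('a) (R m - R n) < e" by blast
  qed
  then obtain y :: "'a padic" where y: "(\<lambda>n. of_rat (R n)) \<longlonglongrightarrow> y"
    using padic_rat_Cauchy_tendsto by blast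
  have "x \<longlonglongrightarrow> y"
    unfolding LIMSEQ_def
  proof (intro allI impI)
    fix e :: real assume "e > 0"
    hence e: "e / 2 > 0" by simp
    obtain N where N: "\<And>n. n \<ge> N \<Longrightarrow> dist (of_rat (R n)) (x n) < e / 2"
      using small[OF e] by blast
    obtain M where M: "\<And>n. n \<ge> M \<Longrightarrow> dist (of_rat (R n)) y < e / 2"
      using y e unfolding LIMSEQ_def by blast
    have "dist (x n) y < e" if "n \<ge> max N M" for n
      using dist_triangle[of "x n" y "of_rat (R n)"] N[of n] M[of n] that
      by (simp add: dist_commute)
    thus "\<exists>N. \<forall>n\<ge>N. dist (x n) y < e" by blast
  qed
  thus "convergent x" by (auto simp: convergent_def)
qed

section \<open>The \<open>p\<close>-adic integers\<close>

definition Zp :: "'p::prime_card padic set" where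
  "Zp = {x. padic_norm x \<le> 1}"

definition Zp_units :: "'p::prime_card padic set" where
  "Zp_units = {x \<in> Zp. \<exists>y\<in>Zp. x * y = 1}"

text \<open>The ideal \<open>p\<^sup>n \<int>\<^sub>p\<close>.\<close>

definition p_power_ideal :: "nat \<Rightarrow> 'p::prime_card padic set" where
  "p_power_ideal n = (\<lambda>t. of_nat CARD('p) ^ n * t) ` Zp"

definition padic_residue :: "'p::prime_card padic \<Rightarrow> nat" where
  "padic_residue x = (THE r. r < CARD('p) \<and> x - of_nat r \<in> p_power_ideal 1)"

section \<open>Powers with exponents \<open>a + s (p - 1)\<close>\<close>

text \<open>
  An exponent is a pair \<open>(a, s)\<close> with \<open>a \<in> \<int>\<close> and \<open>s \<in> \<int>\<^sub>p\<close>, standing for the formal expression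
  \<open>a + s (p - 1)\<close>. The power depends on more than the value of that expression in \<open>\<int>\<^sub>p\<close>:
  \<open>(1, 0)\<close> and \<open>(0, 1 / (p - 1))\<close> have the same value, but nontrivial \<open>(p - 1)\<close>-th roots of unity have
  different powers with these exponents. Exponents are added and subtracted componentwise.
\<close>

type_synonym 'p padic_exponent = "int \<times> 'p padic"

definition exponent_value :: "'p::prime_card padic_exponent \<Rightarrow> 'p padic" where
  "exponent_value e = of_int (fst e) + snd e * of_nat (CARD('p) - 1)"

definition padic_pow :: "'p::prime_card padic \<Rightarrow> 'p padic_exponent \<Rightarrow> 'p padic" where
  "padic_pow w e = (w powi fst e) * (\<Sum>k. (snd e gchoose k) * (w ^ (CARD('p) - 1) - 1) ^ k)"

definition padic_lambda :: "'p::prime_card padic \<Rightarrow> 'p padic_exponent" where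
  "padic_lambda \<alpha> =
     (- int (padic_residue (- \<alpha>)), (\<alpha> + of_nat (padic_residue (- \<alpha>))) / of_nat CARD('p))"

lemma exponent_value_padic_lambda:
  "exponent_value (padic_lambda (\<alpha> :: 'p::prime_card padic)) =
     - of_nat (padic_residue (- \<alpha>)) +
     (\<alpha> + of_nat (padic_residue (- \<alpha>))) / of_nat CARD('p) * (of_nat CARD('p) - 1)"
  using prime_gt_0_nat[OF prime_card[where 'a = 'p]]
  by (simp add: exponent_value_def padic_lambda_def of_nat_diff)

section \<open>Truncated hypergeometric series\<close>

definition hyp2F1_trunc :: "'a::field_char_0 \<Rightarrow> 'a \<Rightarrow> 'a \<Rightarrow> 'a \<Rightarrow> nat \<Rightarrow> 'a" where
  "hyp2F1_trunc \<alpha> \<beta> \<gamma> z n =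
     (\<Sum>k=0..n. pochhammer \<alpha> k * pochhammer \<beta> k / pochhammer \<gamma> k * (z ^ k / fact k))"

end

theory Submission
  imports Defs
begin

text \<open>
  Write \<open>\<alpha> = p s - a\<close> with \<open>0 \<le> a < p\<close> and \<open>s \<in> \<int>\<^sub>p\<close>, so that \<open>1 - \<lambda>\<^sub>p(\<alpha>) = a + 1 - s (p - 1)\<close>.
  Modulo \<open>p\<^sup>2\<close> the difference of the two sides is an affine function of \<open>p s\<close> with coefficients in \<open>\<int>\<^sub>p\<close>,
  so it suffices to treat \<open>s = 0\<close> and \<open>s = -1\<close>. There \<open>\<alpha> = -n\<close> with \<open>n = a\<close> or \<open>n = a + p\<close>, all
  powers have natural exponents, and the right-hand side is a complete sum, to which the classical
  identity \<open>\<Sum>\<^sub>k C(n, 2k) C(2k, k) z\<^sup>k (1 + z)\<^bsup>n - 2k\<^esup> = \<Sum>\<^sub>k C(n, k)\<^sup>2 z\<^sup>k\<close> applies. For \<open>n = a\<close> both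
  sides agree. For \<open>n = a + p\<close> the two truncated sums on the left cover \<open>0, \<dots>, n\<close> and overlap in
  \<open>a < k < p\<close>, where \<open>p\<close> divides \<open>C(n, k)\<close>.
\<close>

section \<open>The quadratic transformation for terminating series\<close>

text \<open>For \<open>j + k \<le> n\<close> both sides are the multinomial coefficient n! / (k! k!
  (j-k)! (n-j-k)!), reached by repeated trinomial revision through C(n, j+k). Otherwise a factor
  vanishes on each side.\<close>

lemma choose_mult_choose_mult_choose:
  fixes n j k :: nat
  assumes "k \<le> j" "j \<le> n"
  shows "(n choose (2 * k)) * ((2 * k) choose k) * ((n - 2 * k) choose (j - k)) =
    (n choose j) * ((j choose k) * ((n - j) choose k))"
proof (cases "j + k \<le> n")
  case True
  have "(n choose (2 * k)) * ((2 * k) choose k) = (n choose k) * ((n - k) choose k)"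
    using choose_mult[of k "2 * k" n] True assms by (simp add: mult_2)
  moreover have "((n - k) choose j) * (j choose k) =
      ((n - k) choose k) * ((n - 2 * k) choose (j - k))"
    using choose_mult[of k j "n - k"] True assms by (simp add: mult_2)
  moreover have "(n choose (j + k)) * ((j + k) choose k) = (n choose k) * ((n - k) choose j)"
    using choose_mult[of k "j + k" n] True by simp
  moreover have "(n choose (j + k)) * ((j + k) choose j) = (n choose j) * ((n - j) choose k)"
    using choose_mult[of j "j + k" n] True by simp
  moreover have "(j + k) choose j = (j + k) choose k"
    using binomial_symmetric[of j "j + k"] by simp
  ultimately show ?thesis by (metis mult.assoc mult.commute)
next
  case False
  thus ?thesis using assms by (cases "2 * k \<le> n") (simp_all add: binomial_eq_0)
qed

text \<open>Vandermonde convolution after the reflection C(j, k) = C(j, j-k).\<close>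

lemma sum_choose_mult_choose: "j \<le> n \<Longrightarrow> (\<Sum>k\<le>j. (j choose k) * ((n - j) choose k)) = n choose j"
proof -
  assume j: "j \<le> n"
  have "(\<Sum>k\<le>j. (j choose k) * ((n - j) choose k)) =
      (\<Sum>k\<le>j. ((n - j) choose k) * (j choose (j - k)))"
    by (intro sum.cong) (simp_all add: binomial_symmetric[symmetric] mult.commute)
  thus ?thesis using vandermonde[of "n - j" j j] j by simp
qed

text \<open>Expanding (1+z)^(n-2k) and collecting powers of z leaves C(n, j) times a Vandermonde sum
  as the coefficient of z^j. The bound on \<open>n\<close> says that \<open>N\<close> reaches n div
  2, so no nonzero term is cut off.\<close>

lemma sum_choose_square_quadratic:
  fixes z :: "'a :: comm_ring_1"
  assumes "n \<le> 2 * N + 1"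
  shows "(\<Sum>k\<le>N. of_nat ((n choose (2 * k)) * ((2 * k) choose k)) * z ^ k * (1 + z) ^ (n - 2 * k)) =
    (\<Sum>j\<le>n. of_nat (n choose j) ^ 2 * z ^ j)"
proof -
  define c where "c k j = (n choose (2 * k)) * ((2 * k) choose k) * ((n - 2 * k) choose (j - k))" for k j
  have expand: "of_nat ((n choose (2 * k)) * ((2 * k) choose k)) * z ^ k * (1 + z) ^ (n - 2 * k) =
      (\<Sum>j\<in>{k..n}. of_nat (c k j) * z ^ j)" for k
  proof (cases "2 * k \<le> n")
    case True
    \<comment> \<open>The range \<open>{k..n}\<close> is longer than the expansion needs, so that
      its upper end is independent of \<open>k\<close> when the sums are exchanged. For j > n-k the
      last binomial in \<open>c\<close> is 0.\<close>
    have "(\<Sum>j\<in>{k..n}. of_nat (c k j) * z ^ j) = (\<Sum>j\<in>{k..n-k}. of_nat (c k j) * z ^ j)"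
      using True by (intro sum.mono_neutral_right) (auto simp: c_def binomial_eq_0)
    also have "\<dots> = (\<Sum>i\<le>n - 2 * k. of_nat (c k (i + k)) * z ^ (i + k))"
      by (rule sum.reindex_bij_witness[of _ "\<lambda>i. i + k" "\<lambda>j. j - k"]) (use True in auto)
    also have "\<dots> = of_nat ((n choose (2 * k)) * ((2 * k) choose k)) * z ^ k * (z + 1) ^ (n - 2 * k)"
      unfolding binomial_ring sum_distrib_left
      by (intro sum.cong) (simp_all add: c_def power_add mult_ac)
    finally show ?thesis by (simp add: add.commute)
  qed (simp add: c_def binomial_eq_0)
  have "(\<Sum>k\<le>N. of_nat ((n choose (2 * k)) * ((2 * k) choose k)) * z ^ k * (1 + z) ^ (n - 2 * k)) =
      (\<Sum>k\<le>N. \<Sum>j\<in>{j. j \<in> {..n} \<and> k \<le> j}. of_nat (c k j) * z ^ j)"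
    unfolding expand by (intro sum.cong) auto
  also have "\<dots> = (\<Sum>j\<le>n. \<Sum>k\<in>{k. k \<in> {..N} \<and> k \<le> j}. of_nat (c k j) * z ^ j)"
    by (rule sum.swap_restrict) auto
  also have "\<dots> = (\<Sum>j\<le>n. of_nat (n choose j) ^ 2 * z ^ j)"
  proof (intro sum.cong refl)
    fix j assume j: "j \<in> {..n}"
    \<comment> \<open>Indices k > N satisfy 2k > n, where the first binomial in \<open>c\<close> is
      0, so the bound \<open>N\<close> drops out.\<close>
    have "(\<Sum>k\<in>{k. k \<in> {..N} \<and> k \<le> j}. c k j) = (\<Sum>k\<le>j. c k j)"
      using assms by (intro sum.mono_neutral_left) (auto simp: c_def binomial_eq_0)
    also have "\<dots> = (n choose j) * (n choose j)"
      using j unfolding c_def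
      by (simp add: choose_mult_choose_mult_choose sum_choose_mult_choose flip: sum_distrib_left)
    finally show "(\<Sum>k\<in>{k. k \<in> {..N} \<and> k \<le> j}. of_nat (c k j) * z ^ j) = of_nat (n choose j) ^ 2 * z ^ j"
      by (simp add: power2_eq_square flip: sum_distrib_right of_nat_sum of_nat_mult)
  qed
  finally show ?thesis .
qed

section \<open>Terminating hypergeometric series as binomial sums\<close>

lemma pochhammer_minus_of_nat:
  "pochhammer (- of_nat n :: 'a :: field_char_0) k = (-1) ^ k * fact k * of_nat (n choose k)"
  by (simp add: binomial_gbinomial gbinomial_pochhammer mult.assoc[symmetric] flip: power_mult_distrib)

text \<open>The signs of the two Pochhammer factors cancel, and their factorials cancel against
  (1)_k and k!.\<close>

lemma hyp2F1_trunc_minus_nat: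
  "hyp2F1_trunc (- of_nat n) (- of_nat n) 1 z N = (\<Sum>k\<le>N. of_nat (n choose k) ^ 2 * z ^ k)"
proof -
  have "((-1) ^ k * (-1) ^ k :: 'a) = 1" for k by (simp flip: power_mult_distrib)
  thus ?thesis unfolding hyp2F1_trunc_def atMost_atLeast0
    by (intro sum.cong)
      (simp_all add: pochhammer_minus_of_nat power2_eq_square mult_ac flip: pochhammer_fact)
qed

text \<open>The duplication formula (\<alpha>)_(2k) = 4^k (\<alpha>/2)_k (1/2 + \<alpha>/2)_k
  absorbs the 4 in the argument.\<close>

lemma hyp2F1_trunc_quadratic:
  fixes z :: "'a :: field_char_0"
  shows "hyp2F1_trunc (1/2 * \<alpha>) (1/2 + 1/2 * \<alpha>) 1 (4 * z / (1 + z)\<^sup>2) N =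
    (\<Sum>k\<le>N. pochhammer \<alpha> (2 * k) / fact k ^ 2 * (z / (1 + z)\<^sup>2) ^ k)"
  unfolding hyp2F1_trunc_def atMost_atLeast0
proof (intro sum.cong refl)
  fix k
  have "pochhammer \<alpha> (2 * k) = 4 ^ k * (pochhammer (1/2 * \<alpha>) k * pochhammer (1/2 + 1/2 * \<alpha>) k)"
    using pochhammer_double[of "1/2 * \<alpha>" k] by (simp add: power_mult add.commute)
  thus "pochhammer (1/2 * \<alpha>) k * pochhammer (1/2 + 1/2 * \<alpha>) k / pochhammer 1 k *
      ((4 * z / (1 + z)\<^sup>2) ^ k / fact k) =
      pochhammer \<alpha> (2 * k) / fact k ^ 2 * (z / (1 + z)\<^sup>2) ^ k"
    by (simp add: power_mult_distrib power_divide power2_eq_square mult_ac flip: pochhammer_fact)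
qed

text \<open>(-n)_(2k) is 0 once 2k > n, so the truncated series is complete and (1+z)^n clears every
  denominator (1+z)^(2k).\<close>

lemma hyp2F1_trunc_quadratic_minus_nat:
  fixes z :: "'a :: field_char_0"
  assumes "1 + z \<noteq> 0" "n \<le> 2 * N + 1"
  shows "(1 + z) ^ n * hyp2F1_trunc (1/2 * (- of_nat n)) (1/2 + 1/2 * (- of_nat n)) 1
      (4 * z / (1 + z)\<^sup>2) N = (\<Sum>k\<le>n. of_nat (n choose k) ^ 2 * z ^ k)"
  unfolding hyp2F1_trunc_quadratic sum_distrib_left
    sum_choose_square_quadratic[OF assms(2), symmetric]
proof (intro sum.cong refl)
  fix k
  show "(1 + z) ^ n * (pochhammer (- of_nat n) (2 * k) / fact k ^ 2 * (z / (1 + z)\<^sup>2) ^ k) =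
      of_nat ((n choose (2 * k)) * ((2 * k) choose k)) * z ^ k * (1 + z) ^ (n - 2 * k)"
  proof (cases "2 * k \<le> n")
    case True
    have "(fact (2 * k) :: 'a) = fact k ^ 2 * of_nat ((2 * k) choose k)"
      using binomial_fact[of k "2 * k", where 'a = 'a] by (simp add: power2_eq_square field_simps)
    moreover have "(1 + z) ^ n = (1 + z) ^ (n - 2 * k) * (1 + z) ^ (2 * k)"
      using True by (simp flip: power_add)
    moreover have "(z / (1 + z)\<^sup>2) ^ k = z ^ k / (1 + z) ^ (2 * k)"
      by (simp add: power_divide power_mult)
    ultimately show ?thesis using assms(1)
      by (simp add: pochhammer_minus_of_nat)
  qed (simp add: pochhammer_minus_of_nat binomial_eq_0)
qed

section \<open>Integrality and congruences\<close>

lemma p_gt_1: "real CARD('p::prime_card) > 1" "real CARD('p) > 0"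
  using prime_gt_1_nat[OF prime_card[where 'a = 'p]] by simp_all

lemma padic_norm_of_int: "padic_norm (of_int a :: 'p::prime_card padic) = padic_abs CARD('p) (of_int a)"
  using padic_norm_of_rat[of "of_int a", where 'p = 'p] by simp

lemma padic_norm_0 [simp]: "padic_norm (0 :: 'p::prime_card padic) = 0"
  by (simp add: padic_norm_eq_0_iff)

text \<open>Bridge between norm estimates and divisibility: for \<open>a \<noteq> 0\<close> the norm
  is p^(-v), with v the multiplicity of p in \<open>a\<close>.\<close>

lemma padic_norm_of_int_le_iff:
  "padic_norm (of_int a :: 'p::prime_card padic) \<le> 1 / real CARD('p) ^ n \<longleftrightarrow> int CARD('p) ^ n dvd a"
proof (cases "a = 0")
  case False
  let ?m = "multiplicity (int CARD('p)) a"
  have nu: "\<not> is_unit (int CARD('p))"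
    using prime_card[where 'a = 'p] by (simp add: prime_nat_iff)
  have "padic_norm (of_int a :: 'p padic) = real CARD('p) powi (- int ?m)"
    using padic_abs_divide[OF prime_card[where 'a = 'p], of a 1] False
    by (simp add: padic_norm_of_int)
  hence "padic_norm (of_int a :: 'p padic) = 1 / real CARD('p) ^ ?m"
    by (simp add: power_int_minus field_simps)
  moreover have "1 / real CARD('p) ^ ?m \<le> 1 / real CARD('p) ^ n \<longleftrightarrow> n \<le> ?m"
    using p_gt_1[where 'p = 'p] by (simp add: field_simps)
  ultimately have "padic_norm (of_int a :: 'p padic) \<le> 1 / real CARD('p) ^ n \<longleftrightarrow> n \<le> ?m" by simp
  thus ?thesis using False nu by (simp add: power_dvd_iff_le_multiplicity)
qed (use p_gt_1[where 'p = 'p] in simp)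

lemma padic_norm_1 [simp]: "padic_norm (1 :: 'p::prime_card padic) = 1"
  using padic_norm_of_int[of 1, where 'p = 'p] by (simp add: prime_card)

lemma padic_norm_power: "padic_norm (x ^ n) = padic_norm (x :: 'p::prime_card padic) ^ n"
  by (induction n) (simp_all add: padic_norm_mult)

lemma padic_norm_inverse: "padic_norm (inverse x) = inverse (padic_norm (x :: 'p::prime_card padic))"
proof (cases "x = 0")
  case False
  hence "padic_norm (inverse x) * padic_norm x = 1" by (simp flip: padic_norm_mult)
  thus ?thesis by (metis inverse_unique mult.commute)
qed simp

lemma padic_norm_divide:
  "padic_norm (x / y) = padic_norm x / padic_norm (y :: 'p::prime_card padic)"
  by (simp add: divide_inverse padic_norm_mult padic_norm_inverse)

lemma padic_norm_add_le:
  fixes x y :: "'p::prime_card padic"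
  shows "padic_norm x \<le> B \<Longrightarrow> padic_norm y \<le> B \<Longrightarrow> padic_norm (x + y) \<le> B"
  using padic_norm_ultra[of x y] by simp

lemma padic_norm_diff_le:
  fixes x y :: "'p::prime_card padic"
  shows "padic_norm x \<le> B \<Longrightarrow> padic_norm y \<le> B \<Longrightarrow> padic_norm (x - y) \<le> B"
  using padic_norm_add_le[of x B "- y"] by (simp add: padic_norm_minus)

lemma padic_norm_diff_commute:
  fixes x y :: "'p::prime_card padic"
  shows "padic_norm (x - y) = padic_norm (y - x)"
  by (metis minus_diff_eq padic_norm_minus)

lemma padic_norm_sum_le:
  fixes f :: "'i \<Rightarrow> 'p::prime_card padic"
  assumes "B \<ge> 0" "\<And>i. i \<in> A \<Longrightarrow> padic_norm (f i) \<le> B"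
  shows "padic_norm (sum f A) \<le> B"
  using assms by (induction A rule: infinite_finite_induct) (auto intro: padic_norm_add_le)

lemma padic_norm_p: "padic_norm (of_nat CARD('p) :: 'p::prime_card padic) = 1 / real CARD('p)"
proof -
  have "padic_abs CARD('p) (of_int (int CARD('p)) / of_int 1) = 1 / real CARD('p)"
    using prime_card[where 'a = 'p]
    by (subst padic_abs_divide) (auto simp: power_int_minus field_simps)
  thus ?thesis using padic_norm_of_int[of "int CARD('p)", where 'p = 'p] by simp
qed

lemma padic_norm_of_int_le_1: "padic_norm (of_int a :: 'p::prime_card padic) \<le> 1"
  using padic_norm_of_int_le_iff[of a 0, where 'p = 'p] by simp

lemma padic_norm_of_int_eq_1:
  assumes "\<not> int CARD('p) dvd a"
  shows "padic_norm (of_int a :: 'p::prime_card padic) = 1"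
proof -
  have "a \<noteq> 0" using assms by auto
  thus ?thesis
    using padic_abs_divide[OF prime_card[where 'a = 'p], of a 1] assms
    by (simp add: padic_norm_of_int not_dvd_imp_multiplicity_0)
qed

lemma padic_norm_of_nat_eq_1:
  assumes "\<not> CARD('p) dvd n"
  shows "padic_norm (of_nat n :: 'p::prime_card padic) = 1"
  using padic_norm_of_int_eq_1[of "int n", where 'p = 'p] assms by simp

section \<open>\<open>Zp\<close> and its ideals as balls of the norm\<close>

lemma Zp_iff: "x \<in> Zp \<longleftrightarrow> padic_norm x \<le> 1"
  by (simp add: Zp_def)

text \<open>Dividing by p^n multiplies the norm by p^n. Congruences thereby become ultrametric
  inequalities.\<close>

lemma p_power_ideal_iff:
  "x \<in> p_power_ideal n \<longleftrightarrow> padic_norm (x :: 'p::prime_card padic) \<le> 1 / real CARD('p) ^ n"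
proof
  assume "x \<in> p_power_ideal n"
  then obtain t where "padic_norm t \<le> 1" "x = of_nat CARD('p) ^ n * t"
    by (auto simp: p_power_ideal_def Zp_iff)
  thus "padic_norm x \<le> 1 / real CARD('p) ^ n"
    using p_gt_1[where 'p = 'p]
    by (simp add: padic_norm_mult padic_norm_power padic_norm_p field_simps power_one_over)
next
  assume le: "padic_norm x \<le> 1 / real CARD('p) ^ n"
  have p0: "(of_nat CARD('p) :: 'p padic) \<noteq> 0" using p_gt_1[where 'p = 'p] by simp
  have "x / of_nat CARD('p) ^ n \<in> Zp"
    using le p_gt_1[where 'p = 'p]
    by (simp add: Zp_iff padic_norm_divide padic_norm_power padic_norm_p field_simps)
  moreover have "x = of_nat CARD('p) ^ n * (x / of_nat CARD('p) ^ n)" using p0 by simp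
  ultimately show "x \<in> p_power_ideal n" unfolding p_power_ideal_def by blast
qed

lemma Zp_of_nat [simp]: "of_nat n \<in> (Zp :: 'p::prime_card padic set)"
  using padic_norm_of_int_le_1[of "int n", where 'p = 'p] by (simp add: Zp_iff)

lemma Zp_0 [simp]: "0 \<in> Zp" and Zp_1 [simp]: "1 \<in> Zp"
  by (simp_all add: Zp_iff)

lemma Zp_add: "x \<in> Zp \<Longrightarrow> y \<in> Zp \<Longrightarrow> x + y \<in> Zp"
  and Zp_diff: "x \<in> Zp \<Longrightarrow> y \<in> Zp \<Longrightarrow> x - y \<in> Zp"
  and Zp_uminus: "x \<in> Zp \<Longrightarrow> - x \<in> Zp"
  by (simp_all add: Zp_iff padic_norm_add_le padic_norm_diff_le padic_norm_minus)

lemma Zp_mult: "x \<in> Zp \<Longrightarrow> y \<in> Zp \<Longrightarrow> x * y \<in> Zp"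
  by (simp add: Zp_iff padic_norm_mult mult_le_one padic_norm_nonneg)

lemma Zp_power: "x \<in> Zp \<Longrightarrow> x ^ n \<in> Zp"
  by (induction n) (simp_all add: Zp_mult)

lemma p_power_ideal_0 [simp]: "0 \<in> p_power_ideal n"
  by (simp add: p_power_ideal_iff)

lemma p_power_ideal_add: "x \<in> p_power_ideal n \<Longrightarrow> y \<in> p_power_ideal n \<Longrightarrow> x + y \<in> p_power_ideal n"
  and p_power_ideal_diff: "x \<in> p_power_ideal n \<Longrightarrow> y \<in> p_power_ideal n \<Longrightarrow> x - y \<in> p_power_ideal n"
  by (simp_all add: p_power_ideal_iff padic_norm_add_le padic_norm_diff_le)

lemma p_power_ideal_sum: "(\<And>i. i \<in> A \<Longrightarrow> f i \<in> p_power_ideal n) \<Longrightarrow> sum f A \<in> p_power_ideal n"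
  by (simp add: p_power_ideal_iff padic_norm_sum_le)

lemma p_power_ideal_mult_left: "x \<in> Zp \<Longrightarrow> y \<in> p_power_ideal n \<Longrightarrow> x * y \<in> p_power_ideal n"
  unfolding p_power_ideal_iff Zp_iff padic_norm_mult
  by (rule order_trans[OF mult_left_le_one_le]) (simp_all add: padic_norm_nonneg)

lemma p_power_ideal_mult_right: "x \<in> p_power_ideal n \<Longrightarrow> y \<in> Zp \<Longrightarrow> x * y \<in> p_power_ideal n"
  using p_power_ideal_mult_left[of y x n] by (simp add: mult.commute)

lemma p_power_ideal_subset_Zp: "x \<in> p_power_ideal n \<Longrightarrow> x \<in> Zp"
  for x :: "'p::prime_card padic"
  by (auto simp: p_power_ideal_def intro!: Zp_mult Zp_power)

lemma of_int_in_p_power_ideal_iff: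
  "(of_int a :: 'p::prime_card padic) \<in> p_power_ideal n \<longleftrightarrow> int CARD('p) ^ n dvd a"
  by (simp add: p_power_ideal_iff padic_norm_of_int_le_iff)

lemma of_nat_in_p_power_ideal_iff:
  "(of_nat a :: 'p::prime_card padic) \<in> p_power_ideal n \<longleftrightarrow> CARD('p) ^ n dvd a"
  using of_int_in_p_power_ideal_iff[of "int a" n, where 'p = 'p]
  by (simp flip: of_nat_power)

text \<open>A rational close enough to \<open>x\<close> is itself a p-adic integer, so its reduced
  denominator is prime to p and can be inverted modulo p^n.\<close>

lemma Zp_approx:
  fixes x :: "'p::prime_card padic"
  assumes "x \<in> Zp"
  obtains m where "x - of_nat m \<in> p_power_ideal n"
proof -
  let ?p = "int CARD('p)"
  have "0 < 1 / real CARD('p) ^ n" using p_gt_1[where 'p = 'p] by simp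
  from padic_rat_dense[OF this, of x] obtain r
    where r: "padic_norm (of_rat r - x) < 1 / real CARD('p) ^ n"
    by (auto simp: dist_padic_def)
  obtain c d where cd: "quotient_of r = (c, d)" by (cases "quotient_of r")
  have d: "d > 0" and cop: "coprime c d" and rcd: "r = of_int c / of_int d"
    using quotient_of_denom_pos[OF cd] quotient_of_coprime[OF cd] quotient_of_div[OF cd] by auto
  have "1 / real CARD('p) ^ n \<le> 1" using p_gt_1[where 'p = 'p] by simp
  hence "padic_norm (of_rat r - x + x) \<le> 1"
    using r assms by (intro padic_norm_add_le) (linarith, simp add: Zp_iff)
  moreover have rcd': "(of_rat r :: 'p padic) = of_int c / of_int d"
    by (simp add: rcd of_rat_divide)
  ultimately have le: "padic_norm (of_int c :: 'p padic) / padic_norm (of_int d :: 'p padic) \<le> 1"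
    by (simp add: padic_norm_divide)
  \<comment> \<open>If p divided the denominator, coprimality would give the numerator norm 1 and
    the quotient a norm above 1.\<close>
  have nd: "\<not> ?p dvd d"
  proof
    assume pd: "?p dvd d"
    hence "\<not> ?p dvd c"
      using cop prime_card[where 'a = 'p] by (metis coprime_common_divisor not_prime_unit prime_nat_int_transfer)
    hence "padic_norm (of_int c :: 'p padic) = 1" by (rule padic_norm_of_int_eq_1)
    moreover have "padic_norm (of_int d :: 'p padic) \<le> 1 / real CARD('p)"
      using padic_norm_of_int_le_iff[of d 1, where 'p = 'p] pd by simp
    moreover have "padic_norm (of_int d :: 'p padic) > 0"
      using d padic_norm_nonneg[of "of_int d :: 'p padic"] padic_norm_eq_0_iff[of "of_int d :: 'p padic"]
      by (simp add: less_le)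
    moreover have "1 / real CARD('p) < 1" using p_gt_1[where 'p = 'p] by simp
    ultimately have "0 < padic_norm (of_int d :: 'p padic)" "padic_norm (of_int d :: 'p padic) < 1"
      "padic_norm (of_int c :: 'p padic) = 1" by linarith+
    thus False using le by (simp add: field_simps)
  qed
  have "coprime d (?p ^ n)"
    using nd prime_card[where 'a = 'p]
    by (metis coprime_commute coprime_power_left_iff prime_imp_coprime prime_nat_int_transfer)
  then obtain y where y: "[d * y = 1] (mod ?p ^ n)" using cong_solve_coprime_int by blast
  define m where "m = nat (y * c mod ?p ^ n)"
  have m: "int m = y * c mod ?p ^ n"
    using prime_gt_0_nat[OF prime_card[where 'a = 'p]] by (simp add: m_def)
  have "[d * int m = (d * y) * c] (mod ?p ^ n)" unfolding m by (simp add: cong_def mod_simps mult.assoc)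
  also have "[(d * y) * c = 1 * c] (mod ?p ^ n)" by (intro cong_mult y cong_refl)
  finally have "?p ^ n dvd c - d * int m" by (simp add: cong_iff_dvd_diff dvd_diff_commute)
  hence "padic_norm (of_int (c - d * int m) :: 'p padic) \<le> 1 / real CARD('p) ^ n"
    by (simp only: padic_norm_of_int_le_iff)
  moreover have "of_rat r - of_nat m = (of_int (c - d * int m) / of_int d :: 'p padic)"
    using d by (simp add: rcd' field_simps)
  ultimately have "padic_norm (of_rat r - of_nat m :: 'p padic) \<le> 1 / real CARD('p) ^ n"
    using padic_norm_of_int_eq_1[OF nd] by (simp add: padic_norm_divide)
  hence "padic_norm ((of_rat r - of_nat m) - (of_rat r - x)) \<le> 1 / real CARD('p) ^ n"
    using r by (rule padic_norm_diff_le[OF _ less_imp_le])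
  thus ?thesis using that[of m] by (simp add: p_power_ideal_iff)
qed

text \<open>A natural number congruent to \<open>x\<close> modulo p is prime to p, hence of norm 1,
  and the ultrametric inequality passes this on to \<open>x\<close>. The hypothesis on z + 1 enters
  the proof here.\<close>

lemma padic_norm_eq_1:
  fixes x :: "'p::prime_card padic"
  assumes "x \<in> Zp" "x \<notin> p_power_ideal 1"
  shows "padic_norm x = 1"
proof (rule ccontr)
  assume "padic_norm x \<noteq> 1"
  hence lt: "padic_norm x < 1" using assms(1) by (simp add: Zp_iff)
  obtain m where m: "x - of_nat m \<in> p_power_ideal 1" using Zp_approx[OF assms(1)] .
  have "\<not> CARD('p) dvd m"
  proof
    assume "CARD('p) dvd m"
    hence "of_nat m \<in> (p_power_ideal 1 :: 'p padic set)" by (simp add: of_nat_in_p_power_ideal_iff)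
    from p_power_ideal_add[OF m this] show False using assms(2) by simp
  qed
  hence "padic_norm (of_nat m :: 'p padic) = 1" by (rule padic_norm_of_nat_eq_1)
  moreover have "padic_norm (x - of_nat m) < 1"
    using m p_gt_1[where 'p = 'p] by (simp add: p_power_ideal_iff order_le_less_trans)
  ultimately show False
    using padic_norm_ultra[of x "- (x - of_nat m)"] lt by (simp add: padic_norm_minus del: minus_diff_eq)
qed

lemma padic_norm_Zp_units:
  assumes "x \<in> Zp_units"
  shows "padic_norm (x :: 'p::prime_card padic) = 1"
proof -
  obtain y where "padic_norm x \<le> 1" "padic_norm y \<le> 1" "x * y = 1"
    using assms by (auto simp: Zp_units_def Zp_iff)
  moreover from this have "padic_norm x * padic_norm y = 1" by (simp flip: padic_norm_mult)
  ultimately show ?thesis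
    using mult_left_mono[of "padic_norm y" 1 "padic_norm x"] padic_norm_nonneg[of x] by simp
qed

text \<open>Justifies the definite description: approximation modulo p gives a residue, and two
  residues below p that differ by a multiple of p coincide.\<close>

lemma padic_residue:
  fixes x :: "'p::prime_card padic"
  assumes "x \<in> Zp"
  shows "padic_residue x < CARD('p)" "x - of_nat (padic_residue x) \<in> p_power_ideal 1"
proof -
  obtain m where m: "x - of_nat m \<in> p_power_ideal 1" using Zp_approx[OF assms] .
  define r where "r = m mod CARD('p)"
  have "CARD('p) dvd m - r" by (simp add: r_def)
  hence "(of_nat (m - r) :: 'p padic) \<in> p_power_ideal 1" by (simp add: of_nat_in_p_power_ideal_iff)
  hence "(x - of_nat m) + of_nat (m - r) \<in> p_power_ideal 1" by (rule p_power_ideal_add[OF m])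
  hence x: "x - of_nat r \<in> p_power_ideal 1" by (simp add: r_def of_nat_diff)
  have r: "r < CARD('p)" using prime_gt_0_nat[OF prime_card[where 'a = 'p]] by (simp add: r_def)
  have "\<exists>!r. r < CARD('p) \<and> x - of_nat r \<in> p_power_ideal 1"
  proof (rule ex1I[of _ r])
    fix q assume q: "q < CARD('p) \<and> x - of_nat q \<in> p_power_ideal 1"
    hence "(x - of_nat r) - (x - of_nat q) \<in> p_power_ideal 1" by (intro p_power_ideal_diff[OF x]) blast
    hence "(of_int (int q - int r) :: 'p padic) \<in> p_power_ideal 1" by simp
    hence "int CARD('p) dvd int q - int r" unfolding of_int_in_p_power_ideal_iff by simp
    hence "int q mod int CARD('p) = int r mod int CARD('p)" by (simp add: mod_eq_dvd_iff)
    thus "q = r" using q r by simp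
  qed (use x r in auto)
  from theI'[OF this] show "padic_residue x < CARD('p)" "x - of_nat (padic_residue x) \<in> p_power_ideal 1"
    unfolding padic_residue_def by auto
qed

section \<open>Powers with \<open>p\<close>-adic exponents modulo \<open>p\<^sup>2\<close>\<close>

text \<open>Exchanging one factor at a time costs at most the norm of \<open>s - t\<close>, the
  other factors being integral. This compares the numerators of binomial coefficients.\<close>

lemma padic_norm_prod_diff_le:
  fixes s t :: "'p::prime_card padic"
  assumes "s \<in> Zp" "t \<in> Zp"
  shows "padic_norm ((\<Prod>i=0..<k. s - of_nat i) - (\<Prod>i=0..<k. t - of_nat i)) \<le> padic_norm (s - t)"
proof (induction k)
  case (Suc k)
  let ?P = "\<lambda>x. \<Prod>i=0..<k. x - (of_nat i :: 'p padic)"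
  have P: "?P x \<in> Zp" if "x \<in> Zp" for x
    by (induction k) (use that in \<open>auto intro!: Zp_mult Zp_diff\<close>)
  have "?P s * (s - of_nat k) - ?P t * (t - of_nat k) =
      (?P s - ?P t) * (s - of_nat k) + ?P t * (s - t)" by (simp add: algebra_simps)
  also have "padic_norm \<dots> \<le> padic_norm (s - t)"
  proof (rule padic_norm_add_le)
    have "padic_norm (s - of_nat k) \<le> 1" using Zp_diff[OF assms(1) Zp_of_nat] by (simp add: Zp_iff)
    thus "padic_norm ((?P s - ?P t) * (s - of_nat k)) \<le> padic_norm (s - t)"
      unfolding padic_norm_mult
      by (intro order_trans[OF mult_right_le_one_le] Suc) (auto simp: padic_norm_nonneg)
    show "padic_norm (?P t * (s - t)) \<le> padic_norm (s - t)"
      unfolding padic_norm_mult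
      by (intro mult_left_le_one_le) (use P[OF assms(2)] in \<open>auto simp: padic_norm_nonneg Zp_iff\<close>)
  qed
  finally show ?case by simp
qed (simp add: padic_norm_nonneg)

text \<open>An ordinary binomial coefficient with \<open>m\<close> close to \<open>s\<close> is a
  natural number and differs from this one by an element of \<open>Zp\<close>.\<close>

lemma gchoose_in_Zp:
  fixes s :: "'p::prime_card padic"
  assumes "s \<in> Zp"
  shows "s gchoose k \<in> Zp"
proof -
  let ?F = "padic_norm (fact k :: 'p padic)"
  have F: "?F > 0"
    using padic_norm_nonneg[of "fact k :: 'p padic"] padic_norm_eq_0_iff[of "fact k :: 'p padic"]
    by (simp add: less_le)
  have "1 / real CARD('p) < 1" using p_gt_1[where 'p = 'p] by simp
  \<comment> \<open>With this \<open>n\<close>, a change of \<open>s\<close> by a multiple of p^n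
    alters the numerator by less than the norm of k!, so the difference stays integral after
    division by k!.\<close>
  then obtain n where n: "(1 / real CARD('p)) ^ n < ?F" using real_arch_pow_inv[OF F] by blast
  obtain m where m: "s - of_nat m \<in> p_power_ideal n" using Zp_approx[OF assms] .
  have "padic_norm (fact k * (s gchoose k) - fact k * (of_nat m gchoose k)) \<le> padic_norm (s - of_nat m)"
    unfolding gbinomial_mult_fact by (rule padic_norm_prod_diff_le) (use assms in auto)
  also have "\<dots> \<le> ?F" using m n by (simp add: p_power_ideal_iff power_one_over)
  finally have "?F * padic_norm ((s gchoose k) - of_nat (m choose k)) \<le> ?F"
    by (simp add: binomial_gbinomial padic_norm_mult flip: right_diff_distrib)
  hence "(s gchoose k) - of_nat (m choose k) \<in> Zp" using F by (simp add: Zp_iff)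
  from Zp_add[OF this Zp_of_nat[of "m choose k"]] show ?thesis by simp
qed

text \<open>By the ultrametric inequality every finite block of terms from index \<open>n\<close> on
  lies in the n-th ideal, and so does its limit.\<close>

lemma padic_suminf_approx:
  fixes f :: "nat \<Rightarrow> 'p::prime_card padic"
  assumes f: "\<And>k. f k \<in> p_power_ideal k"
  shows "suminf f - (\<Sum>k<n. f k) \<in> p_power_ideal n"
proof -
  let ?S = "\<lambda>n. \<Sum>k<n. f k"
  have diff: "?S m - ?S n \<in> p_power_ideal n" if "n \<le> m" for m n
  proof -
    have "?S m - ?S n = (\<Sum>k\<in>{n..<m}. f k)"
      using sum_diff_nat_ivl[of 0 n m f] that by (simp add: lessThan_atLeast0)
    also have "\<dots> \<in> p_power_ideal n"
    proof (intro p_power_ideal_sum)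
      fix k assume "k \<in> {n..<m}"
      hence "1 / real CARD('p) ^ k \<le> 1 / real CARD('p) ^ n"
        using p_gt_1[where 'p = 'p] by (intro divide_left_mono power_increasing) auto
      thus "f k \<in> p_power_ideal n" using f[of k] by (simp add: p_power_ideal_iff)
    qed
    finally show ?thesis .
  qed
  \<comment> \<open>\<open>suminf\<close> carries information only once the series converges;
    completeness turns the Cauchy property into a limit.\<close>
  have "Cauchy ?S"
    unfolding Cauchy_altdef
  proof (intro allI impI)
    fix e :: real assume "e > 0"
    moreover have "1 / real CARD('p) < 1" using p_gt_1[where 'p = 'p] by simp
    ultimately obtain N where N: "(1 / real CARD('p)) ^ N < e" using real_arch_pow_inv by blast
    have "dist (?S m) (?S n) < e" if "m \<ge> N" "n > m" for m n
    proof -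
      have "dist (?S m) (?S n) = padic_norm ((?S n - ?S N) - (?S m - ?S N))"
        by (simp add: dist_padic_def padic_norm_diff_commute)
      also have "\<dots> \<le> 1 / real CARD('p) ^ N"
        using p_power_ideal_diff[OF diff[of N n] diff[of N m]] that by (simp add: p_power_ideal_iff)
      finally show ?thesis using N by (simp add: power_one_over)
    qed
    thus "\<exists>M. \<forall>m\<ge>M. \<forall>n>m. dist (?S m) (?S n) < e" by blast
  qed
  then obtain L where L: "?S \<longlonglongrightarrow> L" using Cauchy_convergent by (auto simp: convergent_def)
  hence "suminf f = L" by (metis sums_def sums_unique)
  moreover obtain m where m: "m \<ge> n" "dist (?S m) L < 1 / real CARD('p) ^ n"
    using metric_LIMSEQ_D[OF L, of "1 / real CARD('p) ^ n"] p_gt_1[where 'p = 'p]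
    by (metis nle_le zero_less_divide_1_iff zero_less_power)
  have "L - ?S m \<in> p_power_ideal n"
    using m(2) by (simp add: p_power_ideal_iff dist_padic_def padic_norm_diff_commute)
  from p_power_ideal_add[OF this diff[OF m(1)]] have "L - ?S n \<in> p_power_ideal n" by simp
  ultimately show ?thesis by simp
qed

text \<open>Fermat's little theorem for a natural number congruent to \<open>w\<close> modulo p,
  carried over by congruence of powers.\<close>

lemma padic_fermat:
  fixes w :: "'p::prime_card padic"
  assumes w: "padic_norm w = 1"
  shows "w ^ (CARD('p) - 1) - 1 \<in> p_power_ideal 1"
proof -
  have "w \<in> Zp" using w by (simp add: Zp_iff)
  then obtain m where m: "w - of_nat m \<in> p_power_ideal 1" using Zp_approx by blast
  have pm: "\<not> CARD('p) dvd m"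
  proof
    assume "CARD('p) dvd m"
    hence "(of_nat m :: 'p padic) \<in> p_power_ideal 1" by (simp add: of_nat_in_p_power_ideal_iff)
    from p_power_ideal_add[OF m this] show False using w p_gt_1[where 'p = 'p] by (simp add: p_power_ideal_iff)
  qed
  have pow: "w ^ k - of_nat m ^ k \<in> p_power_ideal 1" for k
  proof (induction k)
    case (Suc k)
    have "w ^ Suc k - of_nat m ^ Suc k = w ^ k * (w - of_nat m) + (w ^ k - of_nat m ^ k) * of_nat m"
      by (simp add: algebra_simps)
    also have "\<dots> \<in> p_power_ideal 1"
      by (intro p_power_ideal_add p_power_ideal_mult_left p_power_ideal_mult_right Zp_power
        \<open>w \<in> Zp\<close> m Suc Zp_of_nat)
    finally show ?case .
  qed simp
  have "[m ^ (CARD('p) - 1) = 1] (mod CARD('p))" using pm by (rule fermat_theorem[OF prime_card])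
  hence "int CARD('p) dvd int m ^ (CARD('p) - 1) - 1"
    by (metis cong_iff_dvd_diff cong_int_iff of_nat_1 of_nat_power)
  hence "(of_int (int m ^ (CARD('p) - 1) - 1) :: 'p padic) \<in> p_power_ideal 1"
    unfolding of_int_in_p_power_ideal_iff by simp
  from p_power_ideal_add[OF pow[of "CARD('p) - 1"] this] show ?thesis by simp
qed

text \<open>The binomial series is finite here and sums to (1 + (w^(p-1) - 1))^n. This evaluates the
  powers at both interpolation points.\<close>

lemma padic_pow_of_nat:
  "padic_pow w (e, of_nat n) = w powi e * w ^ ((CARD('p) - 1) * n)"
  for w :: "'p::prime_card padic"
proof -
  let ?x = "w ^ (CARD('p) - 1) - 1"
  have "(\<Sum>k. (of_nat n gchoose k) * ?x ^ k) = (\<Sum>k\<le>n. (of_nat n gchoose k) * ?x ^ k)"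
    by (rule suminf_finite) (auto simp: binomial_gbinomial[symmetric] binomial_eq_0)
  also have "\<dots> = (?x + 1) ^ n" unfolding binomial_ring by (simp add: binomial_gbinomial)
  finally show ?thesis by (simp add: padic_pow_def power_mult)
qed

text \<open>w^(p-1) - 1 is a multiple of p and the binomials are integral, so only the terms k = 0
  and k = 1 survive modulo p^2.\<close>

lemma padic_pow_approx:
  fixes w s :: "'p::prime_card padic"
  assumes w: "padic_norm w = 1" and s: "s \<in> Zp"
  shows "padic_pow w (int a, s) - w ^ a * (1 + s * (w ^ (CARD('p) - 1) - 1)) \<in> p_power_ideal 2"
proof -
  let ?x = "w ^ (CARD('p) - 1) - 1"
  have "(s gchoose k) * ?x ^ k \<in> p_power_ideal k" for k
  proof (rule p_power_ideal_mult_left[OF gchoose_in_Zp[OF s]])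
    have "padic_norm ?x ^ k \<le> (1 / real CARD('p)) ^ k"
      using padic_fermat[OF w] by (intro power_mono) (simp_all add: p_power_ideal_iff padic_norm_nonneg)
    thus "?x ^ k \<in> p_power_ideal k"
      by (simp add: p_power_ideal_iff padic_norm_power power_one_over)
  qed
  from padic_suminf_approx[OF this, of 2]
  have "(\<Sum>k. (s gchoose k) * ?x ^ k) - (1 + s * ?x) \<in> p_power_ideal 2"
    by (simp add: numeral_2_eq_2)
  moreover have "w ^ a \<in> Zp" using w by (intro Zp_power) (simp add: Zp_iff)
  ultimately have "w ^ a * ((\<Sum>k. (s gchoose k) * ?x ^ k) - (1 + s * ?x)) \<in> p_power_ideal 2"
    by (intro p_power_ideal_mult_left)
  thus ?thesis by (simp add: padic_pow_def right_diff_distrib)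
qed

section \<open>Functions of \<open>p s\<close> that are affine modulo \<open>p\<^sup>2\<close>\<close>

text \<open>Taking p s rather than s as the variable makes the class closed under products, since
  the square of p s vanishes modulo p^2.\<close>

definition padic_affine :: "('p::prime_card padic \<Rightarrow> 'p padic) \<Rightarrow> bool" where
  "padic_affine f \<longleftrightarrow> (\<exists>c\<in>Zp. \<exists>d\<in>Zp. \<forall>s\<in>Zp. f s - (c + d * (of_nat CARD('p) * s)) \<in> p_power_ideal 2)"

lemma padic_affineI:
  fixes f :: "'p::prime_card padic \<Rightarrow> 'p padic"
  assumes "c \<in> Zp" "d \<in> Zp" "\<And>s. s \<in> Zp \<Longrightarrow> f s - (c + d * (of_nat CARD('p) * s)) \<in> p_power_ideal 2"
  shows "padic_affine f"
  using assms unfolding padic_affine_def by blast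

lemma padic_affineE:
  fixes f :: "'p::prime_card padic \<Rightarrow> 'p padic"
  assumes "padic_affine f"
  obtains c d where "c \<in> Zp" "d \<in> Zp"
    "\<And>s. s \<in> Zp \<Longrightarrow> f s - (c + d * (of_nat CARD('p) * s)) \<in> p_power_ideal 2"
  using assms unfolding padic_affine_def by blast

lemma padic_affine_const: "c \<in> Zp \<Longrightarrow> padic_affine (\<lambda>s. c)"
  by (rule padic_affineI[of c 0]) simp_all

lemma padic_affine_p_mult: "padic_affine (\<lambda>s :: 'p::prime_card padic. of_nat CARD('p) * s)"
  by (rule padic_affineI[of 0 1]) simp_all

lemma padic_affine_add:
  assumes "padic_affine f" "padic_affine g"
  shows "padic_affine (\<lambda>s. f s + g s)"
proof -
  obtain c d where f: "c \<in> Zp" "d \<in> Zp"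
    "\<And>s. s \<in> Zp \<Longrightarrow> f s - (c + d * (of_nat CARD('a) * s)) \<in> p_power_ideal 2"
    using padic_affineE[OF assms(1)] by blast
  obtain c' d' where g: "c' \<in> Zp" "d' \<in> Zp"
    "\<And>s. s \<in> Zp \<Longrightarrow> g s - (c' + d' * (of_nat CARD('a) * s)) \<in> p_power_ideal 2"
    using padic_affineE[OF assms(2)] by blast
  show ?thesis
  proof (rule padic_affineI[of "c + c'" "d + d'"])
    fix s :: "'a padic" assume "s \<in> Zp"
    from p_power_ideal_add[OF f(3)[OF this] g(3)[OF this]]
    show "f s + g s - (c + c' + (d + d') * (of_nat CARD('a) * s)) \<in> p_power_ideal 2"
      by (simp add: algebra_simps)
  qed (simp_all add: f g Zp_add)
qed

lemma padic_affine_mult: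
  assumes "padic_affine f" "padic_affine g"
  shows "padic_affine (\<lambda>s. f s * g s)"
proof -
  obtain c d where f: "c \<in> Zp" "d \<in> Zp"
    "\<And>s. s \<in> Zp \<Longrightarrow> f s - (c + d * (of_nat CARD('a) * s)) \<in> p_power_ideal 2"
    using padic_affineE[OF assms(1)] by blast
  obtain c' d' where g: "c' \<in> Zp" "d' \<in> Zp"
    "\<And>s. s \<in> Zp \<Longrightarrow> g s - (c' + d' * (of_nat CARD('a) * s)) \<in> p_power_ideal 2"
    using padic_affineE[OF assms(2)] by blast
  show ?thesis
  proof (rule padic_affineI[of "c * c'" "c * d' + d * c'"])
    fix s :: "'a padic" assume s: "s \<in> Zp"
    define F where "F = c + d * (of_nat CARD('a) * s)"
    define G where "G = c' + d' * (of_nat CARD('a) * s)"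
    have FG: "F \<in> Zp" "G \<in> Zp" unfolding F_def G_def by (intro Zp_add Zp_mult f g s Zp_of_nat)+
    have fF: "f s - F \<in> p_power_ideal 2" and gG: "g s - G \<in> p_power_ideal 2"
      using f(3)[OF s] g(3)[OF s] by (simp_all add: F_def G_def)
    have "g s \<in> Zp" using Zp_add[OF p_power_ideal_subset_Zp[OF gG] FG(2)] by simp
    hence *: "(f s - F) * g s + F * (g s - G) \<in> p_power_ideal 2"
      by (intro p_power_ideal_add p_power_ideal_mult_left[OF _ gG] p_power_ideal_mult_right[OF fF] FG)
    \<comment> \<open>p^2 times this element is the quadratic term of \<open>F * G\<close>.\<close>
    have "d * d' * s ^ 2 \<in> Zp" by (intro Zp_mult Zp_power f g s)
    hence "of_nat CARD('a) ^ 2 * (d * d' * s ^ 2) \<in> p_power_ideal 2"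
      unfolding p_power_ideal_def by blast
    from p_power_ideal_add[OF * this]
    have "(f s - F) * g s + F * (g s - G) + of_nat CARD('a) ^ 2 * (d * d' * s ^ 2) \<in> p_power_ideal 2" .
    also have "(f s - F) * g s + F * (g s - G) = f s * g s - F * G" by (simp add: algebra_simps)
    also have "F * G = c * c' + (c * d' + d * c') * (of_nat CARD('a) * s) +
        of_nat CARD('a) ^ 2 * (d * d' * s ^ 2)"
      by (simp add: F_def G_def algebra_simps power2_eq_square)
    finally show "f s * g s - (c * c' + (c * d' + d * c') * (of_nat CARD('a) * s)) \<in> p_power_ideal 2"
      by (simp add: algebra_simps)
  qed (intro Zp_add Zp_mult f g)+
qed

lemma padic_affine_sum: "(\<And>i. i \<in> A \<Longrightarrow> padic_affine (f i)) \<Longrightarrow> padic_affine (\<lambda>s. \<Sum>i\<in>A. f i s)"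
  by (induction A rule: infinite_finite_induct) (simp_all add: padic_affine_const padic_affine_add)

lemma padic_affine_pochhammer:
  assumes "padic_affine f"
  shows "padic_affine (\<lambda>s. pochhammer (f s) k)"
proof (induction k)
  case (Suc k)
  thus ?case unfolding pochhammer_Suc
    by (intro padic_affine_mult padic_affine_add padic_affine_const assms Zp_of_nat)
qed (simp add: padic_affine_const)

lemma padic_affine_diff:
  assumes "padic_affine f" "padic_affine g"
  shows "padic_affine (\<lambda>s. f s - g s)"
proof -
  have "padic_affine (\<lambda>s. f s + (- 1) * g s)"
    by (intro padic_affine_add padic_affine_mult padic_affine_const assms Zp_uminus Zp_1)
  thus ?thesis by simp
qed

text \<open>k \<le> n < p keeps 1/k! integral, so each term is an integral constant times two affine
  Pochhammer factors.\<close>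

lemma padic_affine_hyp2F1_trunc:
  fixes z :: "'p::prime_card padic"
  assumes "padic_affine f" "padic_affine g" "z \<in> Zp" "n < CARD('p)"
  shows "padic_affine (\<lambda>s. hyp2F1_trunc (f s) (g s) 1 z n)"
proof -
  have fact: "1 / fact k \<in> (Zp :: 'p padic set)" if "k \<in> {0..n}" for k
  proof -
    have "\<not> CARD('p) dvd fact k"
      using that assms(4) by (simp add: prime_dvd_fact_iff prime_card)
    hence "padic_norm (of_nat (fact k) :: 'p padic) = 1" by (rule padic_norm_of_nat_eq_1)
    thus ?thesis by (simp add: Zp_iff padic_norm_divide)
  qed
  have "padic_affine (\<lambda>s. \<Sum>k=0..n. pochhammer (f s) k * pochhammer (g s) k *
      ((1 / fact k) * (1 / fact k) * z ^ k))"
    by (intro padic_affine_sum padic_affine_mult padic_affine_pochhammer assms(1,2)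
        padic_affine_const Zp_mult Zp_power fact assms(3))
  thus ?thesis by (simp add: hyp2F1_trunc_def flip: pochhammer_fact)
qed

text \<open>With w^(p-1) = 1 + p y the approximation w^a (1 - s p y) is affine in p s. The negated
  \<open>s\<close> is the form it takes in the exponent 1 - \<lambda>_p(\<alpha>).\<close>

lemma padic_affine_padic_pow:
  fixes w :: "'p::prime_card padic"
  assumes w: "padic_norm w = 1"
  shows "padic_affine (\<lambda>s. padic_pow w (int a, - s))"
proof -
  obtain y where y: "y \<in> Zp" "w ^ (CARD('p) - 1) - 1 = of_nat CARD('p) * y"
    using padic_fermat[OF w] by (auto simp: p_power_ideal_def)
  have wa: "w ^ a \<in> Zp" using w by (intro Zp_power) (simp add: Zp_iff)
  show ?thesis
  proof (rule padic_affineI[of "w ^ a" "- (w ^ a * y)"])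
    fix s :: "'p padic" assume "s \<in> Zp"
    from padic_pow_approx[OF w Zp_uminus[OF this], of a]
    show "padic_pow w (int a, - s) - (w ^ a + - (w ^ a * y) * (of_nat CARD('p) * s)) \<in> p_power_ideal 2"
      unfolding y(2) by (simp add: algebra_simps)
  qed (intro Zp_uminus Zp_mult wa y)+
qed

text \<open>The value at 0 yields \<open>c\<close> and the value at -1 yields c - d p, so
  \<open>c\<close> and d p both vanish modulo p^2. At these points p s - a is a nonpositive
  integer.\<close>

lemma padic_affine_interpolation:
  fixes f :: "'p::prime_card padic \<Rightarrow> 'p padic"
  assumes "padic_affine f" "f 0 \<in> p_power_ideal 2" "f (- 1) \<in> p_power_ideal 2" "s \<in> Zp"
  shows "f s \<in> p_power_ideal 2"
proof -
  obtain c d where f: "c \<in> Zp" "d \<in> Zp"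
    "\<And>s. s \<in> Zp \<Longrightarrow> f s - (c + d * (of_nat CARD('p) * s)) \<in> p_power_ideal 2"
    using padic_affineE[OF assms(1)] by blast
  have c: "c \<in> p_power_ideal 2"
    using p_power_ideal_diff[OF assms(2) f(3)[OF Zp_0]] by simp
  have "c - d * of_nat CARD('p) \<in> p_power_ideal 2"
    using p_power_ideal_diff[OF assms(3) f(3)[OF Zp_uminus[OF Zp_1]]] by simp
  from p_power_ideal_diff[OF c this] have "d * of_nat CARD('p) \<in> p_power_ideal 2" by simp
  from p_power_ideal_mult_right[OF this assms(4)]
  have "d * (of_nat CARD('p) * s) \<in> p_power_ideal 2" by (simp add: mult.assoc)
  from p_power_ideal_add[OF f(3)[OF assms(4)] p_power_ideal_add[OF c this]] show ?thesis by simp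
qed

section \<open>The congruence\<close>

text \<open>Both k and a+p-k are below p, so p divides neither of their factorials, yet it divides
  (a+p)!. This is the carry in Kummer's theorem.\<close>

lemma dvd_choose_carry:
  fixes p :: nat
  assumes "prime p" "a < k" "k < p"
  shows "p dvd (a + p) choose k"
proof -
  have "fact k * fact (a + p - k) * ((a + p) choose k) = (fact (a + p) :: nat)"
    using assms by (intro binomial_fact_lemma) simp
  moreover have "p dvd fact (a + p)" using assms(1) by (simp add: prime_dvd_fact_iff)
  ultimately have "p dvd fact k * fact (a + p - k) * ((a + p) choose k)" by simp
  moreover have "\<not> p \<le> a + p - k" using assms by linarith
  ultimately show ?thesis using assms by (simp add: prime_dvd_mult_iff prime_dvd_fact_iff)
qed

text \<open>Reflecting k to n-k turns the truncated series in 1/z into the top part of the sum in z.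
  Natural subtraction gives the lower end 0 when N \<ge> n.\<close>

lemma power_mult_hyp2F1_trunc_inverse:
  fixes z :: "'a :: field_char_0"
  assumes "z \<noteq> 0"
  shows "z ^ n * hyp2F1_trunc (- of_nat n) (- of_nat n) 1 (1 / z) N =
    (\<Sum>k\<in>{n - N..n}. of_nat (n choose k) ^ 2 * z ^ k)"
proof -
  have "z ^ n * hyp2F1_trunc (- of_nat n) (- of_nat n) 1 (1 / z) N =
      (\<Sum>k\<in>{..N}. of_nat (n choose k) ^ 2 * (z ^ n * (1 / z) ^ k))"
    by (simp add: hyp2F1_trunc_minus_nat sum_distrib_left mult_ac)
  also have "\<dots> = (\<Sum>k\<in>{..min n N}. of_nat (n choose k) ^ 2 * (z ^ n * (1 / z) ^ k))"
    by (intro sum.mono_neutral_right) (auto simp: binomial_eq_0)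
  also have "\<dots> = (\<Sum>k\<in>{n - N..n}. of_nat (n choose k) ^ 2 * z ^ k)"
  proof (rule sum.reindex_bij_witness[of _ "\<lambda>k. n - k" "\<lambda>k. n - k"])
    fix k assume k: "k \<in> {..min n N}"
    hence "z ^ n = z ^ (n - k) * z ^ k" by (simp flip: power_add)
    hence "z ^ n * (1 / z) ^ k = z ^ (n - k)" using assms by (simp add: power_one_over)
    thus "of_nat (n choose (n - k)) ^ 2 * z ^ (n - k) = of_nat (n choose k) ^ 2 * (z ^ n * (1 / z) ^ k)"
      using k binomial_symmetric[of k n] by simp
  qed auto
  finally show ?thesis .
qed

text \<open>Writing the parameter as p s - a with \<open>a\<close> fixed makes the difference of the
  two sides a function of \<open>s\<close> that can be interpolated.\<close>

lemma hyp2F1_trunc_congruence: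
  fixes s z :: "'p::prime_card padic"
  assumes p: "odd CARD('p)" and z: "padic_norm z = 1" and z1: "padic_norm (1 + z) = 1"
    and a: "a < CARD('p)" and s: "s \<in> Zp"
  defines "\<alpha> \<equiv> \<lambda>s. of_nat CARD('p) * s - of_nat a"
  shows "hyp2F1_trunc (\<alpha> s) (\<alpha> s) 1 z (CARD('p) - 1)
      + padic_pow z (int (Suc a), - s) * hyp2F1_trunc (\<alpha> s) (\<alpha> s) 1 (1 / z) (CARD('p) - 1)
      - padic_pow (1 + z) (int (Suc a), - s)
        * hyp2F1_trunc (1/2 * \<alpha> s) (1/2 + 1/2 * \<alpha> s) 1 (4 * z / (1 + z)\<^sup>2) (CARD('p) - 1)
    \<in> p_power_ideal 2"
proof -
  let ?N = "CARD('p) - 1"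
  have p0: "CARD('p) > 0" by (simp add: prime_gt_0_nat prime_card)
  have nz: "z \<noteq> 0" "1 + z \<noteq> 0" using z z1 by (auto simp: padic_norm_eq_0_iff)
  have N: "?N < CARD('p)" using p0 by simp
  \<comment> \<open>Oddness of p makes 2 a unit, so that halves of affine functions are
    affine.\<close>
  have "\<not> CARD('p) dvd 2"
  proof
    assume "CARD('p) dvd 2"
    thus False using p primes_dvd_imp_eq[OF prime_card[where 'a = 'p] two_is_prime_nat] by simp
  qed
  from padic_norm_of_nat_eq_1[OF this] have half: "1 / 2 \<in> (Zp :: 'p padic set)"
    by (simp add: Zp_iff padic_norm_divide)
  have zZ: "z \<in> Zp" "1 / z \<in> Zp" using z by (simp_all add: Zp_iff padic_norm_divide)
  have Z4: "4 * z / (1 + z)\<^sup>2 \<in> Zp"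
    using z z1 Zp_of_nat[of 4, where 'p = 'p]
    by (simp add: Zp_iff padic_norm_divide padic_norm_mult padic_norm_power)
  have \<alpha>: "padic_affine \<alpha>" unfolding \<alpha>_def
    by (intro padic_affine_diff padic_affine_p_mult padic_affine_const Zp_of_nat)
  define f where "f s = hyp2F1_trunc (\<alpha> s) (\<alpha> s) 1 z ?N
      + padic_pow z (int (Suc a), - s) * hyp2F1_trunc (\<alpha> s) (\<alpha> s) 1 (1 / z) ?N
      - padic_pow (1 + z) (int (Suc a), - s)
        * hyp2F1_trunc (1/2 * \<alpha> s) (1/2 + 1/2 * \<alpha> s) 1 (4 * z / (1 + z)\<^sup>2) ?N" for s
  have "padic_affine f" unfolding f_def
    by (intro padic_affine_diff padic_affine_add padic_affine_mult padic_affine_hyp2F1_trunc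
        padic_affine_padic_pow padic_affine_const \<alpha> half z z1 zZ Z4 N)
  moreover have "f 0 = 0"
  proof -
    \<comment> \<open>At s = 0 the exponent a+1 exceeds n = a by one, so the claim reads F + z F =
      (1 + z) F with F the full sum.\<close>
    have pow: "padic_pow w (int (Suc a), - 0) = w * w ^ a" for w :: "'p padic"
      using padic_pow_of_nat[of w "int (Suc a)" 0] by (simp del: of_nat_Suc)
    have F: "hyp2F1_trunc (- of_nat a) (- of_nat a) 1 z ?N = (\<Sum>k\<le>a. of_nat (a choose k) ^ 2 * z ^ k)"
      unfolding hyp2F1_trunc_minus_nat
      by (rule sum.mono_neutral_right) (use a in \<open>auto simp: binomial_eq_0\<close>)
    have "a \<le> 2 * ?N + 1" "a - ?N = 0" using a by auto
    thus ?thesis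
      unfolding f_def pow mult.assoc \<alpha>_def mult_zero_right diff_0
        power_mult_hyp2F1_trunc_inverse[OF nz(1)] hyp2F1_trunc_quadratic_minus_nat[OF nz(2) \<open>a \<le> 2 * ?N + 1\<close>] F
      by (simp add: atMost_atLeast0 algebra_simps)
  qed
  moreover have "f (- 1) \<in> p_power_ideal 2"
  proof -
    define n where "n = a + CARD('p)"
    define b where "b k = (of_nat (n choose k) ^ 2 * z ^ k :: 'p padic)" for k
    \<comment> \<open>At s = -1 the exponent a + 1 + (p - 1) is exactly n = a + p, without the extra
      factor met at s = 0.\<close>
    have pow: "padic_pow w (int (Suc a), - (- 1)) = w ^ n" for w :: "'p padic"
    proof -
      have "padic_pow w (int (Suc a), 1) = w ^ Suc a * w ^ (CARD('p) - 1)"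
        using padic_pow_of_nat[of w "int (Suc a)" 1]
        by (simp only: of_nat_1 mult_1_right power_int_of_nat)
      also have "\<dots> = w ^ n" unfolding n_def power_add[symmetric] using p0 by simp
      finally show ?thesis by simp
    qed
    have \<alpha>n: "\<alpha> (- 1) = - of_nat n" by (simp add: \<alpha>_def n_def)
    have n: "n \<le> 2 * ?N + 1" "n - ?N = Suc a" using a by (auto simp: n_def)
    have "f (- 1) = sum b {..?N} + sum b {Suc a..n} - sum b {..n}"
      unfolding f_def pow \<alpha>n power_mult_hyp2F1_trunc_inverse[OF nz(1)]
        hyp2F1_trunc_quadratic_minus_nat[OF nz(2) n(1)]
      unfolding hyp2F1_trunc_minus_nat n(2) b_def ..
    \<comment> \<open>The ranges leave no gap because a < p, so after subtracting the complete sum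
      only the overlap a < k < p remains.\<close>
    also have "sum b {..?N} + sum b {Suc a..n} =
        sum b ({..?N} \<union> {Suc a..n}) + sum b ({..?N} \<inter> {Suc a..n})"
      by (rule sum.union_inter[symmetric]) auto
    also have "{..?N} \<union> {Suc a..n} = {..n}" using a by (auto simp: n_def)
    finally have "f (- 1) = sum b ({..?N} \<inter> {Suc a..n})" by simp
    also have "\<dots> \<in> p_power_ideal 2"
    proof (rule p_power_ideal_sum)
      fix k assume "k \<in> {..?N} \<inter> {Suc a..n}"
      hence "CARD('p) dvd n choose k"
        unfolding n_def using p0 by (intro dvd_choose_carry prime_card) auto
      \<comment> \<open>The squared binomial raises divisibility from p to p^2.\<close>
      hence "CARD('p) ^ 2 dvd (n choose k) ^ 2" by (rule dvd_power_same)
      hence "(of_nat ((n choose k) ^ 2) :: 'p padic) \<in> p_power_ideal 2"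
        by (simp only: of_nat_in_p_power_ideal_iff)
      thus "b k \<in> p_power_ideal 2" unfolding b_def of_nat_power
        by (intro p_power_ideal_mult_right Zp_power zZ)
    qed
    finally show ?thesis .
  qed
  ultimately have "f s \<in> p_power_ideal 2" using s by (simp add: padic_affine_interpolation)
  thus ?thesis unfolding f_def .
qed

theorem theorem2p5:
  fixes \<alpha> z :: "'p::prime_card padic"
  assumes "odd CARD('p)"
    and "\<alpha> \<in> Zp"
    and "z \<in> Zp_units"
    and "z + 1 \<notin> p_power_ideal 1"
  shows "hyp2F1_trunc \<alpha> \<alpha> 1 z (CARD('p) - 1)
           + padic_pow z ((1, 0) - padic_lambda \<alpha>) * hyp2F1_trunc \<alpha> \<alpha> 1 (1 / z) (CARD('p) - 1)
         - padic_pow (1 + z) ((1, 0) - padic_lambda \<alpha>)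
             * hyp2F1_trunc (1/2 * \<alpha>) (1/2 + 1/2 * \<alpha>) 1 (4 * z / (1 + z)\<^sup>2) (CARD('p) - 1)
         \<in> p_power_ideal 2"
proof -
  \<comment> \<open>As \<open>a\<close> is the residue of -\<alpha>, \<alpha> = p (-t) - a for some
    integral t, and the lemma above applies with s = -t.\<close>
  define a where "a = padic_residue (- \<alpha>)"
  have a: "a < CARD('p)" "- \<alpha> - of_nat a \<in> p_power_ideal 1"
    unfolding a_def by (rule padic_residue[OF Zp_uminus[OF assms(2)]])+
  then obtain t where t: "t \<in> Zp" "- \<alpha> - of_nat a = of_nat CARD('p) * t"
    by (auto simp: p_power_ideal_def)
  have p0: "(of_nat CARD('p) :: 'p padic) \<noteq> 0" using p_gt_1[where 'p = 'p] by simp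
  have \<alpha>: "of_nat CARD('p) * (- t) - of_nat a = \<alpha>"
    unfolding mult_minus_right t(2)[symmetric] by simp
  have "(\<alpha> + of_nat a) / of_nat CARD('p) = - t"
    using p0 \<alpha> by (simp add: field_simps)
  \<comment> \<open>Here \<open>padic_lambda \<alpha>\<close> is (-a, -t), subtracted componentwise;
    the double negation matches \<open>- s\<close> at s = -t.\<close>
  hence pow: "(1, 0) - padic_lambda \<alpha> = (int (Suc a), - (- t))"
    by (simp add: padic_lambda_def flip: a_def)
  have z: "padic_norm z = 1" by (rule padic_norm_Zp_units[OF assms(3)])
  have "z + 1 \<in> Zp" using z by (intro Zp_add) (simp_all add: Zp_iff)
  hence "padic_norm (1 + z) = 1" using padic_norm_eq_1[OF _ assms(4)] by (simp add: add.commute)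
  from hyp2F1_trunc_congruence[OF assms(1) z this a(1) Zp_uminus[OF t(1)]]
  show ?thesis unfolding \<alpha> pow .
qed

end
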